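(* Let $p>1$ and let $u$ be an ancient solution of the half-space problem $u_t-\Delta u=|\nabla u|^p$ in $\mathbb{R}^n_+\times(-\infty,0)$, $u=0$ on $\partial\mathbb{R}^n_+\times(-\infty,0)$. Assume that for each $\varepsilon>0$, $$\sup_{\Gamma_R\times(-\infty,-\varepsilon]}|u|=o(R)\quad\text{as } R\to\infty.$$ Then $u$ is independent of $t$ and depends only on the variable $x_n$.
   Context: $\mathbb{R}^n_+:=\{x\in\mathbb{R}^n: x_n>0\}$ and $\Gamma_R:=\{x\in\mathbb{R}^n: 0<x_n<R\}$. An ancient solution of the half-space problem is a function $u\in C^{2,1}(Q)\cap C(\overline Q)$, $Q=\mathbb{R}^n_+\times(-\infty,0)$, satisfying the PDE pointwise in $Q$ and $u=0$ pointwise on $\partial\mathbb{R}^n_+\times(-\infty,0)$ (no a priori growth restriction, no $C^1$ regularity up to the boundary). *)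

theory Defs
  imports "HOL-Analysis.Analysis"
begin

text \<open>The distinguished coordinate k plays the role of x_n.
  Q = R^n_+ x (-inf,0) = {(x,t). x_n > 0, t < 0}.\<close>

definition halfspace_Q :: "'n::finite \<Rightarrow> ((real^'n) \<times> real) set" where
  "halfspace_Q k = {(x, t). 0 < x $ k \<and> t < 0}"

definition ancient_solution_halfspace ::
  "'n::finite \<Rightarrow> real \<Rightarrow> (real^'n \<Rightarrow> real \<Rightarrow> real) \<Rightarrow> bool" where
  "ancient_solution_halfspace k p u \<longleftrightarrow>
     continuous_on (closure (halfspace_Q k)) (\<lambda>(x, t). u x t) \<and>
     (\<exists>(ut :: real^'n \<Rightarrow> real \<Rightarrow> real) (gu :: real^'n \<Rightarrow> real \<Rightarrow> real^'n)
        (hu :: real^'n \<Rightarrow> real \<Rightarrow> real^'n^'n).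
        (\<forall>(x, t) \<in> halfspace_Q k.
           ((\<lambda>s. u x s) has_real_derivative ut x t) (at t) \<and>
           ((\<lambda>y. u y t) has_derivative (\<lambda>h. gu x t \<bullet> h)) (at x) \<and>
           ((\<lambda>y. gu y t) has_derivative (\<lambda>h. hu x t *v h)) (at x) \<and>
           ut x t - (\<Sum>i\<in>UNIV. hu x t $ i $ i) = norm (gu x t) powr p) \<and>
        continuous_on (halfspace_Q k) (\<lambda>(x, t). ut x t) \<and>
        continuous_on (halfspace_Q k) (\<lambda>(x, t). gu x t) \<and>
        continuous_on (halfspace_Q k) (\<lambda>(x, t). hu x t)) \<and>
     (\<forall>x t. x $ k = 0 \<and> t < 0 \<longrightarrow> u x t = 0)"

end

theory Submission
  imports Defs
begin

text \<open>
  Where \<open>\<bar>u\<bar> \<le> M\<close>, the function \<open>U = - ln (2 - u / M)\<close> solves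
  \<open>U\<^sub>t - \<Delta>U + \<bar>\<nabla>U\<bar>\<^sup>2 = (M exp (-U))\<^bsup>p-1\<^esup> \<bar>\<nabla>U\<bar>\<^bsup>p\<^esup>\<close>, whose coefficient is strictly
  decreasing in \<open>U\<close>. Hence, at a positive maximum \<open>m\<close> of a difference of two solutions, there is
  a gain of order \<open>m \<bar>\<nabla>U\<bar>\<^bsup>p\<^esup>\<close>, which beats all error terms produced by penalizations when the
  gradient is large.

  Doubling the space variable with a weight that blows up on the boundary of a ball, a Bernstein
  estimate without third derivatives, gives on a ball of radius \<open>R\<close> inside the half-space a
  Lipschitz constant of order \<open>M / R + R\<^bsup>-1/(p-1)\<^esup>\<close> at the centre; it tends to 0 as \<open>x\<^sub>n \<rightarrow> \<infinity>\<close>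
  because \<open>M = o(R)\<close> and no time scale enters for ancient solutions. So \<open>u\<close> and any translate
  of \<open>u\<close> along the boundary and backwards in time get close as \<open>x\<^sub>n \<rightarrow> \<infinity>\<close>. A maximum principle on
  strips \<open>0 < x\<^sub>n < X\<close> then shows that they coincide; thanks to the gain it needs neither a
  gradient bound nor uniform continuity up to the boundary.
\<close>

subsection \<open>Gradient and Laplacian at a point\<close>

text \<open>\<open>g\<close> is the gradient and \<open>l\<close> the Laplacian; only the diagonal second derivatives are required.\<close>

definition has_jet2 :: "(real^'n \<Rightarrow> real) \<Rightarrow> real^'n \<Rightarrow> real^'n \<Rightarrow> real \<Rightarrow> bool" where
  "has_jet2 f x g l \<longleftrightarrow>
     (\<exists>G h. (\<forall>\<^sub>F y in nhds x. (f has_derivative (\<lambda>v. G y \<bullet> v)) (at y)) \<and> G x = g \<and>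
        (\<forall>i. ((\<lambda>s. G (x + s *\<^sub>R axis i 1) $ i) has_real_derivative h i) (at 0)) \<and>
        l = (\<Sum>i\<in>UNIV. h i))"

section \<open>Calculus rules for gradient and Laplacian\<close>

lemma has_jet2I:
  assumes "\<forall>\<^sub>F y in nhds x. (f has_derivative (\<lambda>v. G y \<bullet> v)) (at y)"
    and "\<And>i. ((\<lambda>s. G (x + s *\<^sub>R axis i 1) $ i) has_real_derivative h i) (at 0)"
    and "G x = g" and "(\<Sum>i\<in>UNIV. h i) = l"
  shows "has_jet2 f x g l"
  using assms unfolding has_jet2_def by blast

lemma has_jet2_add:
  assumes "has_jet2 f x g l" "has_jet2 f' x g' l'"
  shows "has_jet2 (\<lambda>y. f y + f' y) x (g + g') (l + l')"
proof -
  obtain G h where 1: "\<forall>\<^sub>F y in nhds x. (f has_derivative (\<lambda>v. G y \<bullet> v)) (at y)" "G x = g"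
    "\<And>i. ((\<lambda>s. G (x + s *\<^sub>R axis i 1) $ i) has_real_derivative h i) (at 0)" "l = (\<Sum>i\<in>UNIV. h i)"
    using assms(1) unfolding has_jet2_def by blast
  obtain G' h' where 2: "\<forall>\<^sub>F y in nhds x. (f' has_derivative (\<lambda>v. G' y \<bullet> v)) (at y)" "G' x = g'"
    "\<And>i. ((\<lambda>s. G' (x + s *\<^sub>R axis i 1) $ i) has_real_derivative h' i) (at 0)" "l' = (\<Sum>i\<in>UNIV. h' i)"
    using assms(2) unfolding has_jet2_def by blast
  show ?thesis
  proof (rule has_jet2I[where G = "\<lambda>y. G y + G' y" and h = "\<lambda>i. h i + h' i"])
    show "\<forall>\<^sub>F y in nhds x. ((\<lambda>y. f y + f' y) has_derivative (\<lambda>v. (G y + G' y) \<bullet> v)) (at y)"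
      using 1(1) 2(1)
    proof eventually_elim
      case (elim y)
      then show ?case
        using has_derivative_add[OF elim] by (simp add: inner_add_left)
    qed
  qed (use 1 2 in \<open>auto intro!: DERIV_add simp: sum.distrib\<close>)
qed

lemma has_jet2_cmult:
  assumes "has_jet2 f x g l"
  shows "has_jet2 (\<lambda>y. c * f y) x (c *\<^sub>R g) (c * l)"
proof -
  obtain G h where 1: "\<forall>\<^sub>F y in nhds x. (f has_derivative (\<lambda>v. G y \<bullet> v)) (at y)" "G x = g"
    "\<And>i. ((\<lambda>s. G (x + s *\<^sub>R axis i 1) $ i) has_real_derivative h i) (at 0)" "l = (\<Sum>i\<in>UNIV. h i)"
    using assms(1) unfolding has_jet2_def by blast
  show ?thesis
  proof (rule has_jet2I[where G = "\<lambda>y. c *\<^sub>R G y" and h = "\<lambda>i. c * h i"])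
    show "\<forall>\<^sub>F y in nhds x. ((\<lambda>y. c * f y) has_derivative (\<lambda>v. (c *\<^sub>R G y) \<bullet> v)) (at y)"
      using 1(1)
    proof eventually_elim
      case (elim y)
      then show ?case
        using has_derivative_mult_right[OF elim] by simp
    qed
  qed (use 1 in \<open>auto intro!: DERIV_cmult simp: sum_distrib_left\<close>)
qed

lemma has_jet2_diff:
  assumes "has_jet2 f x g l" "has_jet2 f' x g' l'"
  shows "has_jet2 (\<lambda>y. f y - f' y) x (g - g') (l - l')"
  using has_jet2_add[OF assms(1) has_jet2_cmult[OF assms(2), of "-1"]] by simp

lemma has_jet2_translate:
  assumes "has_jet2 f (c + x) g l"
  shows "has_jet2 (\<lambda>y. f (c + y)) x g l"
proof -
  obtain G h where 1: "\<forall>\<^sub>F y in nhds (c + x). (f has_derivative (\<lambda>v. G y \<bullet> v)) (at y)" "G (c + x) = g"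
    "\<And>i. ((\<lambda>s. G (c + x + s *\<^sub>R axis i 1) $ i) has_real_derivative h i) (at 0)" "l = (\<Sum>i\<in>UNIV. h i)"
    using assms(1) unfolding has_jet2_def by blast
  show ?thesis
  proof (rule has_jet2I[where G = "\<lambda>y. G (c + y)" and h = h])
    have "filterlim (\<lambda>y. c + y) (nhds (c + x)) (nhds x)"
      by (intro tendsto_intros filterlim_ident)
    then have "\<forall>\<^sub>F y in nhds x. (f has_derivative (\<lambda>v. G (c + y) \<bullet> v)) (at (c + y))"
      by (rule eventually_compose_filterlim[OF 1(1)])
    then show "\<forall>\<^sub>F y in nhds x. ((\<lambda>y. f (c + y)) has_derivative (\<lambda>v. G (c + y) \<bullet> v)) (at y)"
    proof eventually_elim
      case (elim y)
      have "((\<lambda>y. c + y) has_derivative (\<lambda>v. v)) (at y)"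
        by (auto intro!: derivative_eq_intros)
      from has_derivative_compose[OF this elim] show ?case .
    qed
  qed (use 1 in \<open>auto simp: add.assoc\<close>)
qed

text \<open>Serves the logarithm, the exponential barrier and the blow-up weight. Two of these outer
  functions are smooth on part of the line only, hence the hypothesis on \<open>\<phi>\<close> near
  \<open>f x\<close>. The product rule along each coordinate line yields \<open>d2 * (g $ i)\<close>
  times \<open>g $ i\<close>, and these squares sum to the norm term.\<close>

lemma has_jet2_compose:
  assumes f: "has_jet2 f x g l"
    and \<phi>: "\<forall>\<^sub>F s in nhds (f x). (\<phi> has_real_derivative \<phi>' s) (at s)"
    and \<phi>': "(\<phi>' has_real_derivative d2) (at (f x))"
  shows "has_jet2 (\<lambda>y. \<phi> (f y)) x (\<phi>' (f x) *\<^sub>R g) (d2 * (norm g)\<^sup>2 + \<phi>' (f x) * l)"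
proof -
  obtain G h where 1: "\<forall>\<^sub>F y in nhds x. (f has_derivative (\<lambda>v. G y \<bullet> v)) (at y)" "G x = g"
    "\<And>i. ((\<lambda>s. G (x + s *\<^sub>R axis i 1) $ i) has_real_derivative h i) (at 0)" "l = (\<Sum>i\<in>UNIV. h i)"
    using assms(1) unfolding has_jet2_def by blast
  have fx: "(f has_derivative (\<lambda>v. g \<bullet> v)) (at x)"
    using eventually_nhds_x_imp_x[OF 1(1)] 1(2) by simp
  have "isCont f x"
    using fx has_derivative_continuous by blast
  then have "filterlim f (nhds (f x)) (nhds x)"
    by (simp add: continuous_at tendsto_at_iff_tendsto_nhds)
  then have ev: "\<forall>\<^sub>F y in nhds x. (\<phi> has_real_derivative \<phi>' (f y)) (at (f y))"
    by (rule eventually_compose_filterlim[OF \<phi>])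
  show ?thesis
  proof (rule has_jet2I[where G = "\<lambda>y. \<phi>' (f y) *\<^sub>R G y"
        and h = "\<lambda>i. d2 * (g $ i)\<^sup>2 + \<phi>' (f x) * h i"])
    show "\<forall>\<^sub>F y in nhds x. ((\<lambda>y. \<phi> (f y)) has_derivative (\<lambda>v. (\<phi>' (f y) *\<^sub>R G y) \<bullet> v)) (at y)"
      using 1(1) ev
    proof eventually_elim
      case (elim y)
      from has_derivative_compose[OF elim(1) elim(2)[unfolded has_field_derivative_def]]
      show ?case by simp
    qed
    fix i
    have "((\<lambda>s. x + s *\<^sub>R axis i 1) has_derivative (\<lambda>s. s *\<^sub>R axis i 1)) (at 0)"
      by (auto intro!: derivative_eq_intros)
    from has_derivative_compose[OF this, of f "\<lambda>v. g \<bullet> v"] fx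
    have "((\<lambda>s. f (x + s *\<^sub>R axis i 1)) has_derivative (\<lambda>s. s * g $ i)) (at 0)"
      by (simp add: inner_axis)
    then have d: "((\<lambda>s. f (x + s *\<^sub>R axis i 1)) has_real_derivative g $ i) (at 0)"
      by (simp add: has_field_derivative_def mult_commute_abs)
    have "((\<lambda>s. \<phi>' (f (x + s *\<^sub>R axis i 1))) has_real_derivative d2 * g $ i) (at 0)"
      using DERIV_chain2[of \<phi>' d2 "\<lambda>s. f (x + s *\<^sub>R axis i 1)" 0, OF _ d] \<phi>' by simp
    from DERIV_mult[OF this 1(3)[of i]]
    show "((\<lambda>s. (\<phi>' (f (x + s *\<^sub>R axis i 1)) *\<^sub>R G (x + s *\<^sub>R axis i 1)) $ i)
        has_real_derivative d2 * (g $ i)\<^sup>2 + \<phi>' (f x) * h i) (at 0)"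
      by (simp add: 1(2) power2_eq_square algebra_simps)
  next
    show "(\<Sum>i\<in>UNIV. d2 * (g $ i)\<^sup>2 + \<phi>' (f x) * h i) = d2 * (norm g)\<^sup>2 + \<phi>' (f x) * l"
      by (simp add: sum.distrib 1(4) norm_vec_def L2_set_def sum_nonneg flip: sum_distrib_left)
  qed (simp add: 1)
qed

lemma has_jet2_norm_square:
  fixes a x :: "real^'n"
  shows "has_jet2 (\<lambda>y. (norm (y - a))\<^sup>2) x (2 *\<^sub>R (x - a)) (2 * CARD('n))"
proof (rule has_jet2I[where G = "\<lambda>y. 2 *\<^sub>R (y - a)" and h = "\<lambda>i. 2"])
  show "\<forall>\<^sub>F y in nhds x. ((\<lambda>y. (norm (y - a))\<^sup>2) has_derivative (\<lambda>v. 2 *\<^sub>R (y - a) \<bullet> v)) (at y)"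
    unfolding power2_norm_eq_inner
    by (intro always_eventually allI)
      (auto intro!: derivative_eq_intros simp: inner_commute algebra_simps)
  show "((\<lambda>s. (2 *\<^sub>R (x + s *\<^sub>R axis i 1 - a)) $ i) has_real_derivative 2) (at 0)" for i
    by (auto intro!: derivative_eq_intros simp: axis_def)
qed auto

lemma has_jet2_component: "has_jet2 (\<lambda>y::real^'n. y $ k) x (axis k 1) 0"
  by (rule has_jet2I[where G = "\<lambda>_. axis k 1" and h = "\<lambda>_. 0"])
    (auto intro!: derivative_eq_intros always_eventually bounded_linear_imp_has_derivative
      bounded_linear_vec_nth simp: inner_axis')

section \<open>Necessary conditions at a maximum\<close>

lemma second_derivative_test_max:
  fixes f :: "real \<Rightarrow> real"
  assumes f: "\<forall>\<^sub>F s in nhds 0. (f has_real_derivative f' s) (at s)"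
    and f': "(f' has_real_derivative d2) (at 0)"
    and mx: "\<forall>\<^sub>F s in nhds 0. f s \<le> f 0"
  shows "d2 \<le> 0"
proof (rule ccontr)
  assume "\<not> d2 \<le> 0"
  obtain e where e: "e > 0" "\<And>s. \<bar>s\<bar> < e \<Longrightarrow> (f has_real_derivative f' s) (at s) \<and> f s \<le> f 0"
    using eventually_conj[OF f mx] unfolding eventually_nhds_metric by (auto simp: dist_real_def)
  have "f' 0 = 0"
    using e by (intro DERIV_local_max[of f "f' 0" 0 e]) auto
  \<comment> \<open>Since \<open>f' 0 = 0\<close> and \<open>d2 > 0\<close>, the derivative is
    positive just to the right of 0, so \<open>f\<close> exceeds \<open>f 0\<close> there.\<close>
  with DERIV_pos_inc_right[OF f'] \<open>\<not> d2 \<le> 0\<close>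
  obtain d where d: "d > 0" "\<And>h. 0 < h \<Longrightarrow> h < d \<Longrightarrow> 0 < f' h" by auto
  define s where "s = min d e / 2"
  have s: "0 < s" "s < d" "s < e" using d e by (auto simp: s_def)
  have "f 0 < f s"
  proof (rule DERIV_pos_imp_increasing_open[OF s(1)])
    show "\<exists>y. (f has_real_derivative y) (at x) \<and> 0 < y" if "0 < x" "x < s" for x
      using that s d(2)[of x] e(2)[of x] by auto
    show "continuous_on {0..s} f"
      using e(2) s by (intro DERIV_continuous_on[of _ _ f']) (auto intro: has_field_derivative_at_within)
  qed
  then show False using e(2)[of s] s by auto
qed

text \<open>The second-derivative test on each coordinate line through \<open>x\<close> gives
  \<open>h i \<le> 0\<close>; summing gives the sign of the Laplacian. This is why diagonal second
  derivatives suffice in \<open>has_jet2\<close>.\<close>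

lemma has_jet2_local_max:
  assumes "has_jet2 f x g l" and mx: "\<forall>\<^sub>F y in nhds x. f y \<le> f x"
  shows "g = 0" "l \<le> 0"
proof -
  obtain G h where 1: "\<forall>\<^sub>F y in nhds x. (f has_derivative (\<lambda>v. G y \<bullet> v)) (at y)" "G x = g"
    "\<And>i. ((\<lambda>s. G (x + s *\<^sub>R axis i 1) $ i) has_real_derivative h i) (at 0)" "l = (\<Sum>i\<in>UNIV. h i)"
    using assms(1) unfolding has_jet2_def by blast
  obtain S where S: "open S" "x \<in> S" "\<And>y. y \<in> S \<Longrightarrow> f y \<le> f x"
    using mx unfolding eventually_nhds by blast
  have "(f has_derivative (\<lambda>v. g \<bullet> v)) (at x)"
    using eventually_nhds_x_imp_x[OF 1(1)] 1(2) by simp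
  then have "(\<lambda>v. g \<bullet> v) = (\<lambda>v. 0)"
    using differential_zero_maxmin[OF S(2,1)] S(3) by blast
  then show "g = 0" by (metis inner_eq_zero_iff)
  have "h i \<le> 0" for i
  proof (rule second_derivative_test_max)
    have "filterlim (\<lambda>s. x + s *\<^sub>R axis i 1) (nhds (x + 0 *\<^sub>R axis i 1)) (nhds 0)"
      by (intro tendsto_intros filterlim_ident)
    then have lim: "filterlim (\<lambda>s. x + s *\<^sub>R axis i 1) (nhds x) (nhds 0)" by simp
    show "\<forall>\<^sub>F s in nhds 0. f (x + s *\<^sub>R axis i 1) \<le> f (x + 0 *\<^sub>R axis i 1)"
      using eventually_compose_filterlim[OF mx lim] by simp
    have "\<forall>\<^sub>F s in nhds 0. (f has_derivative (\<lambda>v. G (x + s *\<^sub>R axis i 1) \<bullet> v)) (at (x + s *\<^sub>R axis i 1))"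
      by (rule eventually_compose_filterlim[OF 1(1) lim])
    then show "\<forall>\<^sub>F s in nhds 0. ((\<lambda>s. f (x + s *\<^sub>R axis i 1)) has_real_derivative G (x + s *\<^sub>R axis i 1) $ i) (at s)"
    proof eventually_elim
      case (elim s)
      have "((\<lambda>s. x + s *\<^sub>R axis i 1) has_derivative (\<lambda>s. s *\<^sub>R axis i 1)) (at s)"
        by (auto intro!: derivative_eq_intros)
      from has_derivative_compose[OF this elim] show ?case
        by (simp add: has_field_derivative_def inner_axis mult_commute_abs)
    qed
    show "((\<lambda>s. G (x + s *\<^sub>R axis i 1) $ i) has_real_derivative h i) (at 0)" by (fact 1(3))
  qed
  then show "l \<le> 0" by (simp add: 1(4) sum_nonpos)
qed

text \<open>Maxima over a time interval may sit at its final time, so only the past is compared and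
  only a sign of the derivative results.\<close>

lemma derivative_nonneg_of_left_max:
  fixes f :: "real \<Rightarrow> real"
  assumes "(f has_real_derivative D) (at t)" and "T < t"
    and "\<And>s. T \<le> s \<Longrightarrow> s \<le> t \<Longrightarrow> f s \<le> f t"
  shows "0 \<le> D"
proof (rule ccontr)
  assume "\<not> 0 \<le> D"
  then obtain d where d: "d > 0" "\<And>h. 0 < h \<Longrightarrow> h < d \<Longrightarrow> f t < f (t - h)"
    using DERIV_neg_dec_left[OF assms(1)] by auto
  define h where "h = min d (t - T) / 2"
  have "0 < h" "h < d" "h \<le> t - T" using d(1) assms(2) by (auto simp: h_def)
  then show False using d(2)[of h] assms(3)[of "t - h"] by auto
qed

text \<open>Mean value theorem, with the derivative at the intermediate point bounded by its value
  at \<open>a + b\<close>. The case \<open>a = 0\<close> is separate because the derivative rule for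
  \<open>powr\<close> asks for a positive base.\<close>

lemma powr_add_le:
  fixes a b p :: real
  assumes "p > 1" "0 \<le> a" "0 \<le> b"
  shows "(a + b) powr p - a powr p \<le> p * b * (a + b) powr (p - 1)"
proof (cases "b = 0")
  case False
  then have "b > 0" using assms by simp
  show ?thesis
  proof (cases "a = 0")
    case True
    have "b powr p = b * b powr (p - 1)"
      using \<open>b > 0\<close> by (simp add: powr_diff)
    moreover have "1 * (b * b powr (p - 1)) \<le> p * (b * b powr (p - 1))"
      using assms \<open>b > 0\<close> by (intro mult_right_mono) auto
    ultimately show ?thesis using True \<open>b > 0\<close> assms by (simp add: mult.assoc)
  next
    case False
    then have "a > 0" using assms by simp
    have "\<exists>z>a. z < a + b \<and> (a + b) powr p - a powr p = (a + b - a) * (p * z powr (p - 1))"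
      using \<open>a > 0\<close> \<open>b > 0\<close> by (intro MVT2) (auto intro!: derivative_eq_intros)
    then obtain z where z: "z > a" "z < a + b" "(a + b) powr p - a powr p = b * (p * z powr (p - 1))"
      by auto
    have "z powr (p - 1) \<le> (a + b) powr (p - 1)"
      using z \<open>a > 0\<close> assms by (intro powr_mono2) auto
    then show ?thesis using z \<open>b > 0\<close> assms by (simp add: mult.assoc mult.left_commute)
  qed
qed simp

subsection \<open>The equation and its logarithmic transform\<close>

definition hj_at :: "real \<Rightarrow> (real^'n \<Rightarrow> real \<Rightarrow> real) \<Rightarrow> real^'n \<Rightarrow> real \<Rightarrow> bool" where
  "hj_at p u x t \<longleftrightarrow> (\<exists>ut g l. ((\<lambda>s. u x s) has_real_derivative ut) (at t) \<and>
     has_jet2 (\<lambda>y. u y t) x g l \<and> ut - l = norm g powr p)"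

definition log_hj_at :: "real \<Rightarrow> real \<Rightarrow> (real^'n \<Rightarrow> real \<Rightarrow> real) \<Rightarrow> real^'n \<Rightarrow> real \<Rightarrow> bool" where
  "log_hj_at p M U x t \<longleftrightarrow> (\<exists>Ut g l. ((\<lambda>s. U x s) has_real_derivative Ut) (at t) \<and>
     has_jet2 (\<lambda>y. U y t) x g l \<and>
     Ut - l + (norm g)\<^sup>2 = (M * exp (- U x t)) powr (p - 1) * norm g powr p)"

text \<open>The function \<open>\<phi>(s) = - ln (2 - s / M)\<close> satisfies
  \<open>\<phi>'' = \<phi>'^2\<close> with \<open>\<phi>' = 1 / (M * w)\<close>, so the second-order
  term of the chain rule is exactly the squared gradient of the transform. Since
  \<open>M * w = M * exp (- U)\<close>, dividing the right-hand side by \<open>M * w\<close> leaves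
  the power \<open>p - 1\<close> of this quantity.\<close>

lemma log_hj_at_of_hj_at:
  assumes "hj_at p u x t" "M > 0" "\<bar>u x t\<bar> \<le> M"
  shows "log_hj_at p M (\<lambda>x t. - ln (2 - u x t / M)) x t"
proof -
  obtain ut g l where ut: "((\<lambda>s. u x s) has_real_derivative ut) (at t)"
    and j: "has_jet2 (\<lambda>y. u y t) x g l" and eq: "ut - l = norm g powr p"
    using assms(1) unfolding hj_at_def by blast
  define w where "w = 2 - u x t / M"
  have w: "w > 0" using assms(2,3) unfolding w_def by (auto simp: field_simps abs_le_iff)
  have Mw: "M * w > 0" using w assms(2) by simp
  have dphi: "((\<lambda>s. - ln (2 - s / M)) has_real_derivative 1 / (M * (2 - s / M))) (at s)" if "s < 2 * M" for s
    using that assms(2) by (auto intro!: derivative_eq_intros simp: field_simps)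
  have u2: "u x t < 2 * M" using assms by auto
  have d2: "((\<lambda>s. 1 / (M * (2 - s / M))) has_real_derivative 1 / (M * w)\<^sup>2) (at (u x t))"
    using assms(2) w unfolding w_def
    by (auto intro!: derivative_eq_intros simp: power2_eq_square)
  have 1: "((\<lambda>s. - ln (2 - u x s / M)) has_real_derivative ut / (M * w)) (at t)"
    using DERIV_chain2[OF dphi[OF u2] ut] by (simp add: w_def)
  have "\<forall>\<^sub>F s in nhds (u x t). s < 2 * M"
    using u2 by (intro order_tendstoD(2)[OF filterlim_ident])
  then have ev: "\<forall>\<^sub>F s in nhds (u x t). ((\<lambda>s. - ln (2 - s / M)) has_real_derivative 1 / (M * (2 - s / M))) (at s)"
    by eventually_elim (rule dphi)
  have 2: "has_jet2 (\<lambda>y. - ln (2 - u y t / M)) x ((1 / (M * w)) *\<^sub>R g)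
       (1 / (M * w)\<^sup>2 * (norm g)\<^sup>2 + 1 / (M * w) * l)"
    using has_jet2_compose[OF j ev d2] by (simp add: w_def)
  have n: "norm ((1 / (M * w)) *\<^sub>R g) = norm g / (M * w)" using Mw by simp
  have e: "M * exp (- (- ln (2 - u x t / M))) = M * w" using w by (simp add: w_def)
  have "ut / (M * w) - (1 / (M * w)\<^sup>2 * (norm g)\<^sup>2 + 1 / (M * w) * l) + (norm g / (M * w))\<^sup>2
     = (ut - l) / (M * w)" using Mw by (simp add: diff_divide_distrib power_divide)
  also have "\<dots> = (M * w) powr (p - 1) * (norm g / (M * w)) powr p"
    using Mw by (simp add: eq powr_divide powr_diff)
  finally show ?thesis unfolding log_hj_at_def
    using 1 2 n e by (intro exI[of _ "ut / (M * w)"] exI conjI) (auto simp del: norm_scaleR)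
qed

subsection \<open>Comparison on a strip\<close>

text \<open>\<open>a\<close> is the size of the gradient, \<open>N\<close> that of the gradient of the barrier, which has Laplacian
  \<open>z A\<^sup>2\<close>. For \<open>a \<le> 1\<close> the Laplacian dominates the drift, for \<open>a \<ge> 1\<close> the zero-order gain does.\<close>

lemma drift_absorption:
  fixes p :: real
  assumes p: "p > 1" and \<kappa>: "0 < \<kappa>0" "\<kappa>0 \<le> \<kappa>" "\<kappa> \<le> K"
    and A: "A > 4 * (2 + K * p * 2 powr (p - 1))"
    and z: "0 < z" "z * A \<le> 1 / 2" "z * A * (2 + K * p * 2 powr (p - 1)) \<le> \<kappa>0 * (p - 1) * m"
    and N: "0 \<le> N" "N \<le> 2 * (z * A)" and a: "0 \<le> a" and m: "m > 0"
  shows "2 * a * N + \<kappa> * (p * N * (a + N) powr (p - 1)) - \<kappa> * (p - 1) * (2 * m) * a powr p < z * A\<^sup>2 / 2"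
proof -
  \<comment> \<open>The drift terms are at most \<open>c * N\<close> when \<open>a \<le> 1\<close>
    and at most \<open>N * c * a powr p\<close> when \<open>a \<ge> 1\<close>. The hypothesis on
    \<open>A\<close> beats the first bound, the third hypothesis on \<open>z\<close> the
    second.\<close>
  define c where "c = 2 + K * p * 2 powr (p - 1)"
  have c: "c \<ge> 2" using p \<kappa> by (simp add: c_def)
  then have A0: "A > 0" using A by (simp add: c_def)
  have zA: "z * A > 0" using z(1) A0 by simp
  show ?thesis
  proof (cases "a \<le> 1")
    case True
    have "a + N \<le> 2" using True N z(2) by simp
    then have "(a + N) powr (p - 1) \<le> 2 powr (p - 1)"
      using a N p by (intro powr_mono2) auto
    then have "\<kappa> * (p * N * (a + N) powr (p - 1)) \<le> K * (p * N * 2 powr (p - 1))"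
      using \<kappa> p N by (intro mult_mono mult_left_mono) auto
    moreover have "2 * a * N \<le> 2 * N" using True N a by (simp add: mult_left_le_one_le)
    ultimately have "2 * a * N + \<kappa> * (p * N * (a + N) powr (p - 1)) \<le> c * N"
      by (simp add: c_def algebra_simps)
    also have "\<dots> \<le> c * (2 * (z * A))" using N c by (intro mult_left_mono) auto
    also have "\<dots> < z * A\<^sup>2 / 2"
    proof -
      have "z * A * (4 * c) < z * A * A"
        using zA A by (intro mult_strict_left_mono) (simp_all add: c_def)
      then show ?thesis by (simp add: power2_eq_square algebra_simps)
    qed
    finally have "2 * a * N + \<kappa> * (p * N * (a + N) powr (p - 1)) < z * A\<^sup>2 / 2" .
    moreover have "0 \<le> \<kappa> * (p - 1) * (2 * m) * a powr p" using \<kappa> p m by simp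
    ultimately show ?thesis by linarith
  next
    case False
    then have a1: "a \<ge> 1" by simp
    have "a + N \<le> 2 * a" using a1 N z(2) by simp
    then have "(a + N) powr (p - 1) \<le> (2 * a) powr (p - 1)"
      using a N p by (intro powr_mono2) auto
    also have "\<dots> = 2 powr (p - 1) * a powr (p - 1)" using a by (simp add: powr_mult)
    also have "\<dots> \<le> 2 powr (p - 1) * a powr p"
      using a1 by (intro mult_left_mono powr_mono) auto
    finally have *: "(a + N) powr (p - 1) \<le> 2 powr (p - 1) * a powr p" .
    have "\<kappa> * (p * N * (a + N) powr (p - 1)) \<le> K * (p * N * (2 powr (p - 1) * a powr p))"
      using \<kappa> p N * by (intro mult_mono mult_left_mono) auto
    moreover have "2 * a * N \<le> 2 * N * a powr p"
    proof -
      have "a powr 1 \<le> a powr p" using a1 p by (intro powr_mono) auto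
      then have "2 * N * a \<le> 2 * N * a powr p" using a1 N by (intro mult_left_mono) auto
      then show ?thesis by (simp add: mult_ac)
    qed
    ultimately have "2 * a * N + \<kappa> * (p * N * (a + N) powr (p - 1)) \<le> N * c * a powr p"
      by (simp add: c_def algebra_simps)
    also have "\<dots> \<le> 2 * (z * A) * c * a powr p"
      using N c by (intro mult_right_mono) auto
    also have "\<dots> \<le> 2 * (\<kappa>0 * (p - 1) * m) * a powr p"
      using z(3) by (intro mult_right_mono) (auto simp: c_def)
    also have "\<dots> \<le> 2 * (\<kappa> * (p - 1) * m) * a powr p"
      using \<kappa> p m by (intro mult_right_mono mult_left_mono) auto
    finally have "2 * a * N + \<kappa> * (p * N * (a + N) powr (p - 1)) \<le> \<kappa> * (p - 1) * (2 * m) * a powr p"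
      by (simp add: mult_ac)
    moreover have "z * A\<^sup>2 / 2 > 0" using z(1) A0 by simp
    ultimately show ?thesis by linarith
  qed
qed

text \<open>The two coefficients differ by the factor \<open>exp ((p - 1) * (U - V))\<close>, which
  is at least \<open>1 + (p - 1) * d\<close>.\<close>

lemma zero_order_gain:
  fixes p :: real
  assumes "p > 1" "M > 0" "0 \<le> d" "d \<le> U - V" "0 \<le> Q"
  shows "(M * exp (- U)) powr (p - 1) * Q powr p + (M * exp (- U)) powr (p - 1) * (p - 1) * d * Q powr p
    \<le> (M * exp (- V)) powr (p - 1) * Q powr p"
proof -
  let ?\<kappa> = "(M * exp (- U)) powr (p - 1)"
  have "(M * exp (- V)) powr (p - 1) = ((M * exp (- U)) * exp (U - V)) powr (p - 1)"
    by (simp add: mult.assoc flip: exp_add)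
  also have "\<dots> = ?\<kappa> * exp ((p - 1) * (U - V))"
    using assms(2) by (simp add: powr_mult exp_powr_real mult.commute)
  finally have e: "(M * exp (- V)) powr (p - 1) = ?\<kappa> * exp ((p - 1) * (U - V))" .
  have "1 + (p - 1) * d \<le> 1 + (p - 1) * (U - V)" using assms by simp
  also have "\<dots> \<le> exp ((p - 1) * (U - V))" by simp
  finally have "?\<kappa> * (1 + (p - 1) * d) * Q powr p \<le> ?\<kappa> * exp ((p - 1) * (U - V)) * Q powr p"
    by (intro mult_right_mono mult_left_mono) auto
  then show ?thesis by (simp add: e algebra_simps)
qed

text \<open>Used at a maximum of a penalized difference, where \<open>D\<close> is the gradient of
  the penalty. Cauchy-Schwarz handles the squares, \<open>powr_add_le\<close> the power at a fixed
  coefficient, and \<open>zero_order_gain\<close> the change of coefficient; the last supplies the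
  negative term on which both the strip comparison and the Lipschitz estimate rest.\<close>

lemma log_hj_gradient_difference:
  fixes P Q D :: "real^'n"
  assumes p: "p > 1" and M: "M > 0" and PQ: "P = Q + D" and d: "0 \<le> d" "d \<le> U - V"
  shows "- (norm P)\<^sup>2 + (M * exp (- U)) powr (p - 1) * norm P powr p
      - (- (norm Q)\<^sup>2 + (M * exp (- V)) powr (p - 1) * norm Q powr p)
    \<le> 2 * norm Q * norm D
      + (M * exp (- U)) powr (p - 1) * (p * norm D * (norm Q + norm D) powr (p - 1))
      - (M * exp (- U)) powr (p - 1) * (p - 1) * d * norm Q powr p"
proof -
  define \<kappa> where "\<kappa> = (M * exp (- U)) powr (p - 1)"
  define \<kappa>' where "\<kappa>' = (M * exp (- V)) powr (p - 1)"
  have "(norm P)\<^sup>2 = (norm Q)\<^sup>2 + 2 * (Q \<bullet> D) + (norm D)\<^sup>2"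
    unfolding PQ power2_norm_eq_inner by (simp add: inner_add_left inner_add_right inner_commute)
  moreover have "\<bar>Q \<bullet> D\<bar> \<le> norm Q * norm D" by (rule Cauchy_Schwarz_ineq2)
  moreover have "0 \<le> (norm D)\<^sup>2" by simp
  ultimately have 1: "(norm Q)\<^sup>2 - (norm P)\<^sup>2 \<le> 2 * (norm Q * norm D)" by linarith
  have "norm P powr p \<le> (norm Q + norm D) powr p"
    unfolding PQ by (rule powr_mono2) (use p norm_triangle_ineq in auto)
  also have "\<dots> \<le> norm Q powr p + p * norm D * (norm Q + norm D) powr (p - 1)"
    using powr_add_le[OF p, of "norm Q" "norm D"] by simp
  finally have "\<kappa> * norm P powr p \<le> \<kappa> * (norm Q powr p + p * norm D * (norm Q + norm D) powr (p - 1))"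
    by (rule mult_left_mono) (simp add: \<kappa>_def)
  then have 2: "\<kappa> * norm P powr p \<le> \<kappa> * norm Q powr p + \<kappa> * (p * norm D * (norm Q + norm D) powr (p - 1))"
    by (simp only: distrib_left)
  have 3: "\<kappa> * norm Q powr p + \<kappa> * (p - 1) * d * norm Q powr p \<le> \<kappa>' * norm Q powr p"
    unfolding \<kappa>_def \<kappa>'_def by (rule zero_order_gain[OF p M d]) simp
  have "- (norm P)\<^sup>2 + \<kappa> * norm P powr p - (- (norm Q)\<^sup>2 + \<kappa>' * norm Q powr p)
    \<le> 2 * (norm Q * norm D) + \<kappa> * (p * norm D * (norm Q + norm D) powr (p - 1))
      - \<kappa> * (p - 1) * d * norm Q powr p"
    using 1 2 3 by linarith
  then show ?thesis unfolding \<kappa>_def \<kappa>'_def by (simp only: mult.assoc)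
qed

text \<open>At a maximum of \<open>U - V + \<zeta> exp (A x\<^sub>k) - \<eta> \<bar>x\<bar>\<^sup>2 + \<eta> t\<close> no control on the gradients is available,
  as the equation is not assumed to hold up to the boundary of the strip.\<close>

lemma log_hj_comparison:
  fixes U V :: "real^'n \<Rightarrow> real \<Rightarrow> real"
  assumes p: "p > 1" and M: "M > 0"
    and contU: "continuous_on ({x. 0 \<le> x $ k \<and> x $ k \<le> X} \<times> {..t0}) (\<lambda>(x, t). U x t)"
    and contV: "continuous_on ({x. 0 \<le> x $ k \<and> x $ k \<le> X} \<times> {..t0}) (\<lambda>(x, t). V x t)"
    and bU: "\<And>x t. 0 \<le> x $ k \<Longrightarrow> x $ k \<le> X \<Longrightarrow> t \<le> t0 \<Longrightarrow> - 2 \<le> U x t \<and> U x t \<le> 0"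
    and bV: "\<And>x t. 0 \<le> x $ k \<Longrightarrow> x $ k \<le> X \<Longrightarrow> t \<le> t0 \<Longrightarrow> - 2 \<le> V x t \<and> V x t \<le> 0"
    and sU: "\<And>x t. 0 < x $ k \<Longrightarrow> x $ k < X \<Longrightarrow> t \<le> t0 \<Longrightarrow> log_hj_at p M U x t"
    and sV: "\<And>x t. 0 < x $ k \<Longrightarrow> x $ k < X \<Longrightarrow> t \<le> t0 \<Longrightarrow> log_hj_at p M V x t"
    and bd0: "\<And>x t. x $ k = 0 \<Longrightarrow> t \<le> t0 \<Longrightarrow> U x t \<le> V x t"
    and bdX: "\<And>x t. x $ k = X \<Longrightarrow> t \<le> t0 \<Longrightarrow> U x t - V x t \<le> \<mu>" and \<mu>: "\<mu> \<ge> 0"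
    and x: "0 \<le> x $ k" "x $ k \<le> X" "t \<le> t0"
  shows "U x t - V x t \<le> \<mu>"
proof (rule ccontr)
  assume contra: "\<not> U x t - V x t \<le> \<mu>"
  \<comment> \<open>The excess over \<open>\<mu>\<close> is \<open>4 * m\<close>: the
    \<open>\<eta>\<close> penalties cost at most \<open>m\<close>, the barrier at most
    \<open>m\<close>, and \<open>2 * m\<close> remains for the zero-order gain.\<close>
  define m where "m = (U x t - V x t - \<mu>) / 4"
  have m: "m > 0" "m \<le> 1 / 2" "U x t - V x t = \<mu> + 4 * m"
    using contra bU[OF x] bV[OF x] \<mu> by (auto simp: m_def field_simps)
  \<comment> \<open>As \<open>U\<close> takes values between -2 and 0, \<open>K\<close> and
    \<open>\<kappa>0\<close> below bound the coefficient of the gradient power from above and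
    below.\<close>
  define K where "K = (M * exp 2) powr (p - 1)"
  define c where "c = 2 + K * p * 2 powr (p - 1)"
  have c: "c \<ge> 2" using p by (simp add: c_def K_def)
  define A where "A = 1 + 4 * c"
  have A: "A \<ge> 1" using c by (simp add: A_def)
  define \<kappa>0 where "\<kappa>0 = M powr (p - 1)"
  have \<kappa>0: "\<kappa>0 > 0" using M by (simp add: \<kappa>0_def)
  \<comment> \<open>\<open>zz\<close> is the maximum of the barrier \<open>Z\<close> on the strip.\<close>
  define zz where "zz = min m (min (1 / (2 * A)) (\<kappa>0 * (p - 1) * m / (A * c)))"
  have zz: "zz > 0" using m A c \<kappa>0 p by (simp add: zz_def)
  have zz1: "zz \<le> m" by (simp add: zz_def)
  have zz2: "zz * A \<le> 1 / 2"
  proof -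
    have "zz \<le> 1 / (2 * A)" by (simp add: zz_def)
    then show ?thesis using A by (simp add: field_simps)
  qed
  have zz3: "zz * A * c \<le> \<kappa>0 * (p - 1) * m"
  proof -
    have "zz \<le> \<kappa>0 * (p - 1) * m / (A * c)" by (simp add: zz_def)
    then show ?thesis using A c by (simp add: field_simps)
  qed
  \<comment> \<open>On the strip \<open>Z\<close> ranges between \<open>\<zeta>\<close>, reached at
    the bottom, and \<open>zz\<close>, reached at height \<open>X\<close>. The lower bound
    \<open>\<zeta>\<close> is the yardstick for choosing \<open>\<eta>\<close>.\<close>
  define \<zeta> where "\<zeta> = zz * exp (- A * X)"
  have \<zeta>: "\<zeta> > 0" using zz by (simp add: \<zeta>_def)
  define Z where "Z y = \<zeta> * exp (A * y $ k)" for y :: "real^'n"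
  have Z: "\<zeta> \<le> Z y" "Z y \<le> zz" if "0 \<le> y $ k" "y $ k \<le> X" for y
  proof -
    show "\<zeta> \<le> Z y" using that \<zeta> A by (simp add: Z_def)
    have "Z y = zz * exp (A * (y $ k - X))"
      by (simp add: Z_def \<zeta>_def mult.assoc right_diff_distrib flip: exp_add)
    also have "\<dots> \<le> zz * 1"
      using that A zz by (intro mult_left_mono) (auto simp: mult_le_0_iff)
    finally show "Z y \<le> zz" by simp
  qed
  define n where "n = real CARD('n)"
  \<comment> \<open>The first entry keeps the penalties at \<open>(x, t)\<close> below
    \<open>m\<close>. The second makes the Laplacian of the quadratic plus the time slope at most
    \<open>\<zeta> / 2\<close>. The third keeps the gradient of the quadratic below
    \<open>\<zeta>\<close>.\<close>
  define \<eta> where "\<eta> = min (m / ((norm x)\<^sup>2 + (t0 - t) + 1)) (min (\<zeta> / (2 * (2 * n + 1))) (\<zeta>\<^sup>2 / 16))"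
  have n: "n \<ge> 0" by (simp add: n_def)
  have den: "(norm x)\<^sup>2 + (t0 - t) + 1 > 0" using x(3) by (smt (verit) zero_le_power2)
  have \<eta>: "\<eta> > 0" using m \<zeta> n den by (simp add: \<eta>_def)
  have \<eta>1: "\<eta> * ((norm x)\<^sup>2 + (t0 - t)) \<le> m"
  proof -
    have "\<eta> \<le> m / ((norm x)\<^sup>2 + (t0 - t) + 1)" by (simp add: \<eta>_def)
    then have "\<eta> * ((norm x)\<^sup>2 + (t0 - t) + 1) \<le> m" using den by (simp add: field_simps)
    then show ?thesis using \<eta> by (simp add: distrib_left)
  qed
  have \<eta>2: "(2 * n + 1) * \<eta> \<le> \<zeta> / 2"
  proof -
    have "\<eta> \<le> \<zeta> / (2 * (2 * n + 1))" by (simp add: \<eta>_def)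
    then show ?thesis using n by (simp add: field_simps)
  qed
  have \<eta>3: "16 * \<eta> \<le> \<zeta>\<^sup>2" by (simp add: \<eta>_def)
  define \<Phi> where "\<Phi> y s = U y s - V y s + Z y - \<eta> * (norm y)\<^sup>2 + \<eta> * (s - t0)" for y s
  \<comment> \<open>\<open>\<Phi> \<ge> 0\<close> forces
    \<open>\<eta> * (norm y)\<^sup>2 \<le> 3\<close> and \<open>\<eta> * (t0 - s) \<le> 3\<close>.
    With 4 in place of 3 in the truncation, a maximum over \<open>D\<close> lies neither on the
    sphere nor at the initial time.\<close>
  define \<rho> where "\<rho> = 2 / sqrt \<eta>"
  have \<rho>: "\<eta> * \<rho>\<^sup>2 = 4" "\<rho> > 0" using \<eta> by (auto simp: \<rho>_def power_divide)
  define D where "D = ({y. 0 \<le> y $ k \<and> y $ k \<le> X} \<inter> cball 0 \<rho>) \<times> {t0 - 4 / \<eta>..t0}"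
  have cl: "closed {y::real^'n. 0 \<le> y $ k \<and> y $ k \<le> X}"
    by (intro closed_Collect_conj closed_Collect_le continuous_intros)
  have "compact D" unfolding D_def
    by (intro compact_Times closed_Int_compact cl compact_cball compact_Icc)
  have \<Phi>x: "\<Phi> x t \<ge> \<mu> + 3 * m"
    using m \<eta>1 Z(1)[of x] x \<zeta> by (simp add: \<Phi>_def algebra_simps)
  have bound: "\<eta> * (norm y)\<^sup>2 \<le> 3" "\<eta> * (t0 - s) \<le> 3"
    if "0 \<le> y $ k" "y $ k \<le> X" "s \<le> t0" "\<Phi> y s \<ge> 0" for y s
  proof -
    have "\<eta> * (norm y)\<^sup>2 + \<eta> * (t0 - s) \<le> 3"
      using bU[OF that(1-3)] bV[OF that(1-3)] Z(2)[OF that(1,2)] zz1 m that(4)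
      by (simp add: \<Phi>_def algebra_simps)
    moreover have "0 \<le> \<eta> * (norm y)\<^sup>2" "0 \<le> \<eta> * (t0 - s)" using \<eta> that(3) by auto
    ultimately show "\<eta> * (norm y)\<^sup>2 \<le> 3" "\<eta> * (t0 - s) \<le> 3" by linarith+
  qed
  have inside: "norm y < \<rho>" "t0 - 4 / \<eta> < s"
    if "0 \<le> y $ k" "y $ k \<le> X" "s \<le> t0" "\<Phi> y s \<ge> 0" for y s
  proof -
    have "\<eta> * (norm y)\<^sup>2 < \<eta> * \<rho>\<^sup>2" using bound(1)[OF that] \<rho> by simp
    then have "(norm y)\<^sup>2 < \<rho>\<^sup>2" using \<eta> by simp
    then show "norm y < \<rho>" using \<rho>(2) by (simp add: power2_less_imp_less)
    show "t0 - 4 / \<eta> < s" using bound(2)[OF that] \<eta> by (simp add: field_simps)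
  qed
  have "(x, t) \<in> D"
    using inside[of x t] x \<Phi>x m \<mu> by (auto simp: D_def)
  have "D \<subseteq> {x. 0 \<le> x $ k \<and> x $ k \<le> X} \<times> {..t0}" by (auto simp: D_def)
  note c' = continuous_on_subset[OF contU this] continuous_on_subset[OF contV this]
  have "continuous_on D (\<lambda>w. \<Phi> (fst w) (snd w))"
    using c' unfolding \<Phi>_def Z_def by (auto simp: case_prod_beta intro!: continuous_intros)
  from continuous_attains_sup[OF \<open>compact D\<close> _ this] \<open>(x, t) \<in> D\<close>
  obtain y s where ys: "(y, s) \<in> D" "\<And>y' s'. (y', s') \<in> D \<Longrightarrow> \<Phi> y' s' \<le> \<Phi> y s" by fastforce
  have \<Phi>ys: "\<Phi> y s \<ge> \<mu> + 3 * m" using ys(2)[OF \<open>(x, t) \<in> D\<close>] \<Phi>x by linarith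
  have y: "0 \<le> y $ k" "y $ k \<le> X" "s \<le> t0" using ys(1) by (auto simp: D_def)
  have ins: "norm y < \<rho>" "t0 - 4 / \<eta> < s" using inside[OF y] \<Phi>ys m \<mu> by auto
  have "0 \<le> \<eta> * (norm y)\<^sup>2" "0 \<le> \<eta> * (t0 - s)" using \<eta> y by auto
  then have UV: "U y s - V y s \<ge> \<mu> + 2 * m"
    using \<Phi>ys Z(2)[OF y(1,2)] zz1 by (simp add: \<Phi>_def algebra_simps)
  \<comment> \<open>The two faces of the strip are excluded by the boundary hypotheses, since
    \<open>U - V\<close> exceeds \<open>\<mu>\<close> at the maximum.\<close>
  have y0: "0 < y $ k" using bd0[of y s] UV y m \<mu> by (cases "y $ k = 0") auto
  have yX: "y $ k < X" using bdX[of y s] UV y m \<mu> by (cases "y $ k = X") auto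
  obtain Ut P l where U: "((\<lambda>r. U y r) has_real_derivative Ut) (at s)" "has_jet2 (\<lambda>z. U z s) y P l"
    "Ut - l + (norm P)\<^sup>2 = (M * exp (- U y s)) powr (p - 1) * norm P powr p"
    using sU[OF y0 yX y(3)] unfolding log_hj_at_def by blast
  obtain Vt Q l' where V: "((\<lambda>r. V y r) has_real_derivative Vt) (at s)" "has_jet2 (\<lambda>z. V z s) y Q l'"
    "Vt - l' + (norm Q)\<^sup>2 = (M * exp (- V y s)) powr (p - 1) * norm Q powr p"
    using sV[OF y0 yX y(3)] unfolding log_hj_at_def by blast
  have jZ: "has_jet2 Z y ((A * Z y) *\<^sub>R axis k 1) (A\<^sup>2 * Z y)"
  proof -
    have "has_jet2 (\<lambda>z. \<zeta> * exp (A * z $ k)) y ((\<zeta> * A * exp (A * y $ k)) *\<^sub>R axis k 1)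
      (\<zeta> * A\<^sup>2 * exp (A * y $ k) * (norm (axis k 1 :: real^'n))\<^sup>2 + \<zeta> * A * exp (A * y $ k) * 0)"
      by (rule has_jet2_compose[where \<phi>' = "\<lambda>r. \<zeta> * A * exp (A * r)", OF has_jet2_component])
        (auto intro!: derivative_eq_intros always_eventually simp: power2_eq_square)
    then show ?thesis by (simp add: Z_def[abs_def] mult_ac)
  qed
  have j: "has_jet2 (\<lambda>z. \<Phi> z s) y (P - Q + (A * Z y) *\<^sub>R axis k 1 - \<eta> *\<^sub>R (2 *\<^sub>R y))
      (l - l' + A\<^sup>2 * Z y - \<eta> * (2 * n))"
  proof -
    have cst: "has_jet2 (\<lambda>z. \<eta> * (s - t0)) y 0 0"
      by (rule has_jet2I[where G = "\<lambda>_. 0" and h = "\<lambda>_. 0"]) auto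
    show ?thesis
      using has_jet2_add[OF has_jet2_diff[OF has_jet2_add[OF has_jet2_diff[OF U(2) V(2)] jZ]
            has_jet2_cmult[OF has_jet2_norm_square[of 0 y], of \<eta>]] cst]
      by (simp add: \<Phi>_def[abs_def] n_def)
  qed
  have "open ({z. 0 < z $ k} \<inter> {z. z $ k < X} \<inter> ball 0 \<rho>)"
    by (intro open_Int open_ball open_Collect_less continuous_intros)
  moreover have "y \<in> {z. 0 < z $ k} \<inter> {z. z $ k < X} \<inter> ball 0 \<rho>" using y0 yX ins by simp
  ultimately have "\<forall>\<^sub>F z in nhds y. z \<in> {z. 0 < z $ k} \<inter> {z. z $ k < X} \<inter> ball 0 \<rho>"
    by (rule eventually_nhds_in_open)
  then have "\<forall>\<^sub>F z in nhds y. \<Phi> z s \<le> \<Phi> y s"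
  proof eventually_elim
    case (elim z)
    then show ?case using ys(1) by (intro ys(2)) (auto simp: D_def)
  qed
  from has_jet2_local_max[OF j this]
  have g0: "P - Q + (A * Z y) *\<^sub>R axis k 1 - \<eta> *\<^sub>R (2 *\<^sub>R y) = 0"
    and l0: "l - l' + A\<^sup>2 * Z y - \<eta> * (2 * n) \<le> 0" by blast+
  have "((\<lambda>r. \<Phi> y r) has_real_derivative Ut - Vt + \<eta>) (at s)"
    unfolding \<Phi>_def using U(1) V(1) by (auto intro!: derivative_eq_intros)
  then have time0: "0 \<le> Ut - Vt + \<eta>"
    by (rule derivative_nonneg_of_left_max[OF _ ins(2)]) (use ys in \<open>auto simp: D_def\<close>)
  define N where "N = \<eta> *\<^sub>R (2 *\<^sub>R y) - (A * Z y) *\<^sub>R axis k 1"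
  have P: "P = Q + N" using g0 by (simp add: N_def algebra_simps)
  have N: "norm N \<le> 2 * (Z y * A)"
  proof -
    have "norm N \<le> \<eta> * (2 * norm y) + A * Z y"
      using norm_triangle_ineq4[of "\<eta> *\<^sub>R (2 *\<^sub>R y)" "(A * Z y) *\<^sub>R axis k 1"] \<eta> A Z(1)[OF y(1,2)] \<zeta>
      by (simp add: N_def)
    moreover have "(\<eta> * (2 * norm y))\<^sup>2 \<le> \<zeta>\<^sup>2"
    proof -
      have "(\<eta> * (2 * norm y))\<^sup>2 = 4 * \<eta> * (\<eta> * (norm y)\<^sup>2)" by (simp add: power2_eq_square)
      also have "\<dots> \<le> 4 * \<eta> * 3"
        using bound(1)[OF y] \<Phi>ys m \<mu> \<eta> by (intro mult_left_mono) auto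
      also have "\<dots> \<le> \<zeta>\<^sup>2" using \<eta>3 \<eta> by simp
      finally show ?thesis .
    qed
    then have "\<eta> * (2 * norm y) \<le> \<zeta>" using \<zeta> power2_le_imp_le by fastforce
    moreover have "\<zeta> \<le> Z y * A"
      using Z(1)[OF y(1,2)] A \<zeta> mult_mono[of \<zeta> "Z y" 1 A] by simp
    ultimately show ?thesis by (simp add: mult.commute)
  qed
  have \<kappa>: "\<kappa>0 \<le> (M * exp (- U y s)) powr (p - 1)" "(M * exp (- U y s)) powr (p - 1) \<le> K"
    using bU[OF y] M p by (auto simp: \<kappa>0_def K_def intro!: powr_mono2)
  have "Z y > 0" using Z(1)[OF y(1,2)] \<zeta> by simp
  \<comment> \<open>The conditions at the maximum bound the difference of the two right-hand sides
    from below by \<open>A\<^sup>2 * Z y - (2 * n + 1) * \<eta>\<close>, while absorption makes it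
    less than \<open>Z y * A\<^sup>2 / 2\<close>. This contradicts
    \<open>(2 * n + 1) * \<eta> \<le> \<zeta> / 2\<close> and
    \<open>\<zeta> \<le> Z y * A\<^sup>2\<close>.\<close>
  have "2 * norm Q * norm N
      + (M * exp (- U y s)) powr (p - 1) * (p * norm N * (norm Q + norm N) powr (p - 1))
      - (M * exp (- U y s)) powr (p - 1) * (p - 1) * (2 * m) * norm Q powr p < Z y * A\<^sup>2 / 2"
  proof (rule drift_absorption[OF p \<kappa>0 \<kappa>])
    show "A > 4 * (2 + K * p * 2 powr (p - 1))" by (simp add: A_def c_def)
    have "Z y * A \<le> zz * A" using Z(2)[OF y(1,2)] A by (intro mult_right_mono) auto
    then show "Z y * A \<le> 1 / 2" using zz2 by linarith
    have "Z y * A * c \<le> zz * A * c" using Z(2)[OF y(1,2)] A c by (intro mult_right_mono) auto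
    then show "Z y * A * (2 + K * p * 2 powr (p - 1)) \<le> \<kappa>0 * (p - 1) * m"
      using zz3 by (simp add: c_def)
  qed (use \<open>Z y > 0\<close> N m in auto)
  moreover have "- (norm P)\<^sup>2 + (M * exp (- U y s)) powr (p - 1) * norm P powr p
      - (- (norm Q)\<^sup>2 + (M * exp (- V y s)) powr (p - 1) * norm Q powr p) \<ge> - \<eta> + A\<^sup>2 * Z y - 2 * n * \<eta>"
    using U(3) V(3) time0 l0 by (simp add: algebra_simps)
  moreover have "2 * m \<le> U y s - V y s" "0 \<le> 2 * m" using UV \<mu> m by auto
  note log_hj_gradient_difference[OF p M P this(2,1)]
  moreover have "\<zeta> \<le> Z y * A\<^sup>2"
    using Z(1)[OF y(1,2)] A \<zeta> mult_mono[of \<zeta> "Z y" 1 "A\<^sup>2"] by (simp add: one_le_power)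
  ultimately show False using \<eta>2 by (simp add: algebra_simps)
qed

subsection \<open>Interior Lipschitz estimate\<close>

lemma has_jet2_imp_has_derivative:
  assumes "has_jet2 f x g l"
  shows "(f has_derivative (\<lambda>v. g \<bullet> v)) (at x)"
  using assms unfolding has_jet2_def by (auto dest: eventually_nhds_x_imp_x)

section \<open>The weight that blows up on a sphere, and its barrier inequality\<close>

lemma DERIV_blowup_power:
  fixes c s :: real
  assumes "0 < c" "s < c"
  shows "((\<lambda>s. (c / (c - s)) ^ n) has_real_derivative n * (c / (c - s)) ^ (n + 1) / c) (at s)"
proof -
  have d: "((\<lambda>s. c / (c - s)) has_real_derivative (c / (c - s))\<^sup>2 / c) (at s)"
    using assms by (auto intro!: derivative_eq_intros simp: power2_eq_square)
  have "(of_nat n * (c / (c - s)) ^ (n - 1)) * ((c / (c - s))\<^sup>2 / c) = n * (c / (c - s)) ^ (n + 1) / c"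
    by (cases n) (auto simp: power2_eq_square)
  with DERIV_power[OF d, of n] show ?thesis
    by (simp add: mult_ac)
qed

text \<open>Each differentiation of a power of \<open>c / (c - s)\<close> raises the exponent by one
  and divides by \<open>c\<close>. Composing with the squared distance, with
  \<open>c = R\<^sup>2\<close>, gives gradient and Laplacian as explicit powers of
  \<open>w\<close>.\<close>

lemma has_jet2_blowup_power:
  fixes a x :: "real^'n"
  assumes R: "0 < R" and x: "norm (x - a) < R"
  defines "w \<equiv> R\<^sup>2 / (R\<^sup>2 - (norm (x - a))\<^sup>2)"
  shows "has_jet2 (\<lambda>y. L * (R\<^sup>2 / (R\<^sup>2 - (norm (y - a))\<^sup>2)) ^ q) x
    ((L * q * w ^ (q + 1) / R\<^sup>2) *\<^sub>R (2 *\<^sub>R (x - a)))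
    (L * q * (q + 1) * w ^ (q + 2) / R ^ 4 * (2 * norm (x - a))\<^sup>2 + L * q * w ^ (q + 1) / R\<^sup>2 * (2 * CARD('n)))"
proof -
  have lt: "(norm (x - a))\<^sup>2 < R\<^sup>2" using x R by (intro power_strict_mono) auto
  have R2: "0 < R\<^sup>2" using R by simp
  have n2: "norm (2 *\<^sub>R (x - a)) = 2 * norm (x - a)" by simp
  show ?thesis
    unfolding n2[symmetric] w_def
  proof (rule has_jet2_compose[where \<phi>' = "\<lambda>s. L * q * (R\<^sup>2 / (R\<^sup>2 - s)) ^ (q + 1) / R\<^sup>2",
        OF has_jet2_norm_square])
    have "\<forall>\<^sub>F s in nhds ((norm (x - a))\<^sup>2). s < R\<^sup>2"
      using lt by (intro order_tendstoD(2)[OF filterlim_ident])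
    then show "\<forall>\<^sub>F s in nhds ((norm (x - a))\<^sup>2). ((\<lambda>s. L * (R\<^sup>2 / (R\<^sup>2 - s)) ^ q)
        has_real_derivative L * q * (R\<^sup>2 / (R\<^sup>2 - s)) ^ (q + 1) / R\<^sup>2) (at s)"
    proof eventually_elim
      case (elim s)
      show ?case by (rule DERIV_cong[OF DERIV_cmult[OF DERIV_blowup_power[OF R2 elim]]]) simp
    qed
    show "((\<lambda>s. L * q * (R\<^sup>2 / (R\<^sup>2 - s)) ^ (q + 1) / R\<^sup>2) has_real_derivative
        L * q * (q + 1) * (R\<^sup>2 / (R\<^sup>2 - (norm (x - a))\<^sup>2)) ^ (q + 2) / R ^ 4) (at ((norm (x - a))\<^sup>2))"
      by (rule DERIV_cong[OF DERIV_cmult[OF DERIV_blowup_power[OF R2 lt], of "L * q / R\<^sup>2" "q + 1", simplified times_divide_eq_left]])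
        (simp add: power2_eq_square power4_eq_xxxx)
  qed
qed

text \<open>The weight \<open>\<Lambda>\<close> has to satisfy this inequality near the sphere, where \<open>w \<rightarrow> \<infinity>\<close>. Comparing powers
  of \<open>w\<close> leads to \<open>q + 1 \<le> p q\<close>; for \<open>p \<ge> 2\<close> the exponent \<open>q = 1\<close> would do.\<close>

lemma blowup_barrier:
  fixes p M R L n w \<Lambda> d \<Delta> \<kappa> :: real and q :: nat
  assumes p: "p > 1" and M: "M > 0" and R: "R > 0" and L: "L > 0" and q: "q \<ge> 1" "q + 1 \<le> p * q"
    and c1: "4 * q \<le> L * R" and c2: "p * 2 powr (p + 1) * q \<le> (p - 1) * (L * R)"
    and c3: "16 * q * (n + 2 * q + 2) \<le> (p - 1) * ((M * L) powr (p - 1) * R)" and n: "n \<ge> 0"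
    and w: "w \<ge> 1" and \<Lambda>: "\<Lambda> = L * w ^ q" and d: "0 \<le> d" "d \<le> 2 * q * L * w ^ (q + 1) / R"
    and \<Delta>: "\<Delta> \<le> 2 * q * (n + 2 * q + 2) * L * w ^ (q + 2) / R\<^sup>2"
    and \<kappa>: "M powr (p - 1) \<le> \<kappa>"
  shows "\<Delta> + 2 * \<Lambda> * d + \<kappa> * (p * 2 powr (p - 1) * \<Lambda> powr (p - 1) * d) \<le> (p - 1) * \<kappa> * \<Lambda> * \<Lambda> powr p"
proof -
  define S where "S = (M * L) powr (p - 1)"
  define C where "C = n + 2 * q + 2"
  have S: "S > 0" using M L by (simp add: S_def)
  have C: "C \<ge> 1" using n by (simp add: C_def)
  have \<kappa>0: "\<kappa> > 0" using \<kappa> M by (smt (verit) powr_gt_zero)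
  have wq: "w ^ q \<ge> w" using w q power_increasing[of 1 q w] by simp
  have \<Lambda>0: "\<Lambda> > 0" using L w by (simp add: \<Lambda>)
  \<comment> \<open>Here \<open>q + 1 \<le> p * q\<close> enters, as
    \<open>w ^ (q + 1) \<le> (w ^ q) powr p\<close>. The scales match because
    \<open>S * L = M powr (p - 1) * L powr p\<close>.\<close>
  have E: "S * L * w ^ (q + 1) \<le> \<kappa> * \<Lambda> powr p"
  proof -
    have "w ^ (q + 1) = w powr (q + 1)" using w by (subst powr_realpow) auto
    also have "\<dots> \<le> w powr (p * q)" using w q by (intro powr_mono) auto
    also have "\<dots> = (w ^ q) powr p" using w by (simp add: powr_powr mult.commute flip: powr_realpow)
    finally have 1: "w ^ (q + 1) \<le> (w ^ q) powr p" .
    have "S * L * w ^ (q + 1) \<le> S * L * (w ^ q) powr p"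
      using 1 S L by (intro mult_left_mono) auto
    also have "\<dots> = M powr (p - 1) * \<Lambda> powr p"
      using M L w by (simp add: S_def \<Lambda> powr_mult powr_diff)
    also have "\<dots> \<le> \<kappa> * \<Lambda> powr p" using \<kappa> by (intro mult_right_mono) auto
    finally show ?thesis .
  qed
  \<comment> \<open>The right-hand side is shared out: one half for the drift from the power (by
    \<open>c2\<close>), one quarter for the quadratic drift (by \<open>c3\<close>), and one quarter
    for the Laplacian (by \<open>c3\<close> together with \<open>L * R \<ge> 1\<close>).\<close>
  have t3: "\<kappa> * (p * 2 powr (p - 1) * \<Lambda> powr (p - 1) * d) \<le> (p - 1) / 2 * (\<kappa> * \<Lambda> * \<Lambda> powr p)"
  proof -
    have "p * 2 powr (p - 1) * d \<le> p * 2 powr (p - 1) * (2 * q * L * w ^ (q + 1) / R)"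
      using d p by (intro mult_left_mono) auto
    also have "\<dots> = (p * 2 powr (p + 1) * q) * (\<Lambda> * w) / (2 * R)"
      by (simp add: \<Lambda> powr_add powr_diff)
    also have "\<dots> \<le> ((p - 1) * (L * R)) * (\<Lambda> * w) / (2 * R)"
      using c2 \<Lambda>0 w R by (intro divide_right_mono mult_right_mono) auto
    also have "\<dots> = (p - 1) / 2 * \<Lambda> * (L * w)" using R by simp
    also have "\<dots> \<le> (p - 1) / 2 * \<Lambda> * \<Lambda>"
      using wq p \<Lambda>0 L by (intro mult_left_mono) (auto simp: \<Lambda>)
    finally have "p * 2 powr (p - 1) * d * (\<kappa> * \<Lambda> powr (p - 1)) \<le> (p - 1) / 2 * \<Lambda> * \<Lambda> * (\<kappa> * \<Lambda> powr (p - 1))"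
      using \<kappa>0 by (intro mult_right_mono) auto
    moreover have "\<Lambda> powr p = \<Lambda> * \<Lambda> powr (p - 1)" using \<Lambda>0 by (simp add: powr_diff)
    ultimately show ?thesis by (simp add: mult_ac)
  qed
  have c3': "16 * q * C \<le> (p - 1) * (S * R)" using c3 by (simp add: S_def C_def)
  have t2: "2 * \<Lambda> * d \<le> (p - 1) / 4 * (\<kappa> * \<Lambda> * \<Lambda> powr p)"
  proof -
    have "16 * real q \<le> 16 * q * C" using C mult_left_mono[of 1 C "real q"] by simp
    with c3' have c: "16 * real q \<le> (p - 1) * (S * R)" by linarith
    have "2 * d \<le> 2 * (2 * q * L * w ^ (q + 1) / R)" using d by simp
    also have "\<dots> = (16 * q) * (L * w ^ (q + 1)) / (4 * R)" by simp
    also have "\<dots> \<le> ((p - 1) * (S * R)) * (L * w ^ (q + 1)) / (4 * R)"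
      using c L w R by (intro divide_right_mono mult_right_mono) auto
    also have "\<dots> = (p - 1) / 4 * (S * L * w ^ (q + 1))" using R by simp
    also have "\<dots> \<le> (p - 1) / 4 * (\<kappa> * \<Lambda> powr p)"
      using E p by (intro mult_left_mono) auto
    finally have "2 * d * \<Lambda> \<le> (p - 1) / 4 * (\<kappa> * \<Lambda> powr p) * \<Lambda>"
      using \<Lambda>0 by (intro mult_right_mono) auto
    then show ?thesis by (simp add: mult_ac)
  qed
  have t1: "\<Delta> \<le> (p - 1) / 4 * (\<kappa> * \<Lambda> * \<Lambda> powr p)"
  proof -
    have LR: "L * R \<ge> 1" using c1 q by linarith
    have "0 \<le> real q * C" using C by simp
    then have "8 * q * C \<le> (p - 1) * (S * R)" using c3' by linarith
    also have "\<dots> \<le> (p - 1) * (S * R) * (L * R)"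
      using LR p S R mult_left_mono[of 1 "L * R" "(p - 1) * (S * R)"] by simp
    finally have c: "8 * q * C \<le> (p - 1) * (S * R) * (L * R)" .
    have "\<Delta> \<le> 2 * q * C * L * w ^ (q + 2) / R\<^sup>2" using \<Delta> by (simp add: C_def)
    also have "\<dots> = (8 * q * C) * (L * w ^ (q + 2)) / (4 * R\<^sup>2)" by simp
    also have "\<dots> \<le> ((p - 1) * (S * R) * (L * R)) * (L * w ^ (q + 2)) / (4 * R\<^sup>2)"
      using c L w R by (intro divide_right_mono mult_right_mono) auto
    also have "\<dots> = (p - 1) / 4 * (S * L * w ^ (q + 1) * (L * w))"
      using R by (simp add: power2_eq_square)
    also have "\<dots> \<le> (p - 1) / 4 * (\<kappa> * \<Lambda> powr p * \<Lambda>)"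
    proof (rule mult_left_mono[OF mult_mono[OF E]])
      show "L * w \<le> \<Lambda>" using wq L by (simp add: \<Lambda>)
    qed (use p L w \<kappa>0 in auto)
    finally show ?thesis by (simp add: mult_ac)
  qed
  show ?thesis using t1 t2 t3 by (simp add: field_simps)
qed

text \<open>Maximize \<open>U(x,t) - U(y,t) - \<Lambda>(x) \<bar>x - y\<bar> + \<eta> t\<close>. Varying \<open>y\<close> gives \<open>\<bar>\<nabla>U(y)\<bar> = \<Lambda>(x)\<close>, and moving
  \<open>x\<close> and \<open>y\<close> jointly keeps \<open>r = \<bar>x - y\<bar>\<close> fixed, so that \<open>\<nabla>U(x) - \<nabla>U(y) = r \<nabla>\<Lambda>\<close> and
  \<open>\<Delta>U(x) - \<Delta>U(y) \<le> r \<Delta>\<Lambda>\<close>: all terms are proportional to \<open>r\<close>, as if the equation had been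
  differentiated.\<close>

lemma log_hj_lipschitz:
  fixes U :: "real^'n \<Rightarrow> real \<Rightarrow> real" and p M R L :: real and q :: nat
  assumes p: "p > 1" and M: "M > 0" and R: "R > 0" and L: "L > 0" and q: "q \<ge> 1" "q + 1 \<le> p * q"
    and c1: "4 * q \<le> L * R" and c2: "p * 2 powr (p + 1) * q \<le> (p - 1) * (L * R)"
    and c3: "16 * q * (CARD('n) + 2 * q + 2) \<le> (p - 1) * ((M * L) powr (p - 1) * R)"
    and cont: "continuous_on (cball a (2 * R) \<times> {..t0}) (\<lambda>(x, t). U x t)"
    and bU: "\<And>x t. x \<in> cball a (2 * R) \<Longrightarrow> t \<le> t0 \<Longrightarrow> - 2 \<le> U x t \<and> U x t \<le> 0"
    and sU: "\<And>x t. x \<in> ball a (2 * R) \<Longrightarrow> t \<le> t0 \<Longrightarrow> log_hj_at p M U x t"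
    and b: "b \<in> cball a (2 * R)" and t: "t \<le> t0"
  shows "U a t - U b t \<le> L * norm (a - b)"
proof (rule ccontr)
  assume contra: "\<not> U a t - U b t \<le> L * norm (a - b)"
  define m where "m = (U a t - U b t - L * norm (a - b)) / 2"
  have m: "m > 0" using contra by (simp add: m_def)
  \<comment> \<open>The first entry makes the gain caused by the excess \<open>m\<close> at least
    \<open>2 * \<eta>\<close>, more than the time slope of the penalty; the second keeps the penalty
    at time \<open>t\<close> below \<open>m\<close>, half of the excess.\<close>
  define \<eta> where "\<eta> = min ((p - 1) * M powr (p - 1) * L powr p * m / 2) (m / (t0 - t + 1))"
  have \<eta>: "\<eta> > 0" using p M L m t by (simp add: \<eta>_def)
  have \<eta>1: "\<eta> * (t0 - t) \<le> m"
  proof -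
    have "\<eta> \<le> m / (t0 - t + 1)" by (simp add: \<eta>_def)
    then have "\<eta> * (t0 - t + 1) \<le> m" using t by (simp add: field_simps)
    then show ?thesis using \<eta> by (simp add: distrib_left)
  qed
  have \<eta>2: "2 * \<eta> \<le> (p - 1) * M powr (p - 1) * L powr p * m" by (simp add: \<eta>_def)
  define w where "w x = R\<^sup>2 / (R\<^sup>2 - (norm (x - a))\<^sup>2)" for x :: "real^'n"
  define \<Lambda> where "\<Lambda> x = L * w x ^ q" for x
  define \<Phi> where "\<Phi> x y s = U x s - U y s - \<Lambda> x * norm (x - y) + \<eta> * (s - t0)" for x y s
  have w1: "w x \<ge> 1" if "norm (x - a) < R" for x
  proof -
    have "(norm (x - a))\<^sup>2 < R\<^sup>2" using that R by (intro power_strict_mono) auto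
    then show ?thesis using R by (simp add: w_def)
  qed
  have \<Phi>a: "\<Phi> a b t \<ge> m"
  proof -
    have "2 * m = U a t - U b t - L * norm (a - b)" by (simp add: m_def)
    then have "\<Phi> a b t = 2 * m - \<eta> * (t0 - t)"
      using R by (simp add: \<Phi>_def \<Lambda>_def w_def algebra_simps)
    then show ?thesis using \<eta>1 by linarith
  qed
  \<comment> \<open>Differences of values of \<open>U\<close> are at most 2, so
    \<open>\<Phi> \<ge> m\<close> forces \<open>\<eta> * (t0 - s) < 3\<close>, and the maximum is
    attained strictly after \<open>T\<close>.\<close>
  define T where "T = t0 - 3 / \<eta>"
  have ball_sub: "cball a (2 * R) \<times> {T..t0} \<subseteq> cball a (2 * R) \<times> {..t0}" by auto
  \<comment> \<open>Uniform continuity keeps \<open>x\<close> and \<open>y\<close> at distance at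
    least \<open>r0\<close> at the maximum. So the norm is differentiable there, and the bound on
    \<open>\<Lambda> x * r\<close> keeps the weight bounded.\<close>
  have "uniformly_continuous_on (cball a (2 * R) \<times> {T..t0}) (\<lambda>(x, t). U x t)"
    by (intro compact_uniformly_continuous continuous_on_subset[OF cont ball_sub] compact_Times) auto
  then obtain r0 where r0: "r0 > 0"
    and r0': "\<And>z z'. z \<in> cball a (2 * R) \<times> {T..t0} \<Longrightarrow> z' \<in> cball a (2 * R) \<times> {T..t0} \<Longrightarrow>
      dist z' z < r0 \<Longrightarrow> dist ((\<lambda>(x, t). U x t) z') ((\<lambda>(x, t). U x t) z) < m"
    using m unfolding uniformly_continuous_on_def by metis
  have uc: "r0 \<le> norm (x - y)"
    if "x \<in> cball a (2 * R)" "y \<in> cball a (2 * R)" "T \<le> s" "s \<le> t0" "U x s - U y s \<ge> m" for x y s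
  proof (rule ccontr)
    assume "\<not> r0 \<le> norm (x - y)"
    then have "\<bar>U x s - U y s\<bar> < m"
      using r0'[of "(y, s)" "(x, s)"] that by (simp add: dist_Pair_Pair dist_real_def dist_norm)
    then show False using that by linarith
  qed
  \<comment> \<open>On \<open>\<bar>x - a\<bar> \<ge> R'\<close> the weight exceeds \<open>2 / r0\<close>, so no maximum occurs there and \<open>D\<close> can be compact.\<close>
  define \<theta> where "\<theta> = min (R\<^sup>2 / 2) (L * R\<^sup>2 * r0 / 3)"
  have \<theta>: "\<theta> > 0" "3 * \<theta> \<le> L * R\<^sup>2 * r0" using R L r0 by (auto simp: \<theta>_def)
  have "\<theta> \<le> R\<^sup>2 / 2" "0 < R\<^sup>2" using R by (auto simp: \<theta>_def)
  then have \<theta>R: "\<theta> < R\<^sup>2" by linarith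
  define R' where "R' = sqrt (R\<^sup>2 - \<theta>)"
  have R'2: "R'\<^sup>2 = R\<^sup>2 - \<theta>" using \<theta>R by (simp add: R'_def)
  have R'0: "R' > 0" using \<theta>R by (simp add: R'_def)
  have R': "R' < R" using R'2 \<theta>(1) R by (intro power2_less_imp_less[of R' R]) auto
  define D where "D = cball a R' \<times> cball a (2 * R) \<times> {T..t0}"
  have "compact D" unfolding D_def by (intro compact_Times compact_cball compact_Icc)
  have time: "T < s" if "x \<in> cball a R'" "y \<in> cball a (2 * R)" "s \<le> t0" "\<Phi> x y s \<ge> m" for x y s
  proof -
    have "x \<in> cball a (2 * R)" using that R' R by (auto simp: dist_norm)
    moreover have "0 \<le> \<Lambda> x * norm (x - y)"
      using w1[of x] that R' L by (simp add: \<Lambda>_def dist_norm norm_minus_commute)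
    ultimately have "\<eta> * (t0 - s) < 3"
      using bU[of x s] bU[of y s] that m by (simp add: \<Phi>_def algebra_simps)
    then show ?thesis using \<eta> by (simp add: T_def field_simps)
  qed
  have "(a, b, t) \<in> D"
    using b time[of a b t] t \<Phi>a R'0 by (auto simp: D_def)
  have "continuous_on D (\<lambda>z. \<Phi> (fst z) (fst (snd z)) (snd (snd z)))"
  proof -
    have "D \<subseteq> {z. norm (fst z - a) < R}" using R' by (auto simp: D_def dist_norm norm_minus_commute)
    then have nz: "\<And>z. z \<in> D \<Longrightarrow> R\<^sup>2 - (norm (fst z - a))\<^sup>2 \<noteq> 0"
      using R by (metis (mono_tags, lifting) abs_of_nonneg abs_of_pos diff_eq_diff_eq diff_self less_irrefl
          mem_Collect_eq norm_ge_zero power2_eq_iff_nonneg subset_iff less_imp_le)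
    have 1: "continuous_on D (\<lambda>z. (\<lambda>(x, t). U x t) (fst z, snd (snd z)))"
      by (rule continuous_on_compose2[OF cont]) (use R' R in \<open>auto simp: D_def intro!: continuous_intros\<close>)
    have 2: "continuous_on D (\<lambda>z. (\<lambda>(x, t). U x t) (fst (snd z), snd (snd z)))"
      by (rule continuous_on_compose2[OF cont]) (auto simp: D_def intro!: continuous_intros)
    show ?thesis using 1 2 nz unfolding \<Phi>_def \<Lambda>_def w_def prod.case
      by (auto intro!: continuous_intros simp: case_prod_beta)
  qed
  from continuous_attains_sup[OF \<open>compact D\<close> _ this] \<open>(a, b, t) \<in> D\<close>
  obtain x y s where xys: "(x, y, s) \<in> D"
    "\<And>x' y' s'. (x', y', s') \<in> D \<Longrightarrow> \<Phi> x' y' s' \<le> \<Phi> x y s" by fastforce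
  have \<Phi>xys: "\<Phi> x y s \<ge> m" using xys(2)[OF \<open>(a, b, t) \<in> D\<close>] \<Phi>a by linarith
  define r where "r = norm (x - y)"
  have x: "x \<in> cball a R'" "x \<in> cball a (2 * R)" "norm (x - a) < R" and y: "y \<in> cball a (2 * R)"
    and s: "s \<le> t0" "T < s"
    using xys(1) R' R time[of x y s] \<Phi>xys by (auto simp: D_def dist_norm norm_minus_commute)
  have w: "w x \<ge> 1" using w1[OF x(3)] .
  have wq: "w x \<le> w x ^ q" using w q power_increasing[of 1 q "w x"] by simp
  have \<Lambda>L: "\<Lambda> x \<ge> L" using w L by (simp add: \<Lambda>_def)
  then have \<Lambda>0: "\<Lambda> x > 0" using L by simp
  have "\<eta> * (t0 - s) \<ge> 0" using \<eta> s by simp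
  then have gap: "\<Lambda> x * r + m \<le> U x s - U y s"
    using \<Phi>xys by (simp add: \<Phi>_def r_def algebra_simps)
  have "0 \<le> \<Lambda> x * r" using \<Lambda>0 by (simp add: r_def)
  then have r: "r0 \<le> r" using uc[OF x(2) y, of s] gap s by (simp add: r_def)
  then have r_pos: "r > 0" using r0 by simp
  have \<Lambda>r: "\<Lambda> x * r \<le> 2" using gap bU[OF x(2) s(1)] bU[OF y s(1)] m by linarith
  have Lwr: "L * w x * r \<le> 2"
  proof -
    have "L * w x * r \<le> L * w x ^ q * r" using wq L r_pos by (intro mult_right_mono mult_left_mono) auto
    then show ?thesis using \<Lambda>r by (simp add: \<Lambda>_def)
  qed
  have xR': "norm (x - a) < R'"
  proof (rule ccontr)
    assume "\<not> norm (x - a) < R'"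
    then have "norm (x - a) = R'" using x(1) by (simp add: dist_norm norm_minus_commute)
    then have "R\<^sup>2 = w x * \<theta>" using \<theta>(1) by (simp add: w_def R'2)
    then have "L * R\<^sup>2 * r \<le> 2 * \<theta>" using mult_right_mono[OF Lwr, of \<theta>] \<theta>(1) by (simp add: mult_ac)
    moreover have "L * R\<^sup>2 * r0 \<le> L * R\<^sup>2 * r" using r L by (intro mult_left_mono) auto
    ultimately show False using \<theta> by linarith
  qed
  have LR4: "L * R \<ge> 4" using c1 q by linarith
  \<comment> \<open>\<open>L * r \<le> 2\<close> and \<open>L * R \<ge> 4\<close> give
    \<open>r < R\<close>, so \<open>y\<close> is interior to the ball of radius \<open>2 * R\<close>
    and the equation holds at \<open>y\<close> too.\<close>
  have yR: "norm (y - a) < 2 * R"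
  proof -
    have "L * r \<le> 2" using \<Lambda>L \<Lambda>r r_pos mult_right_mono[OF \<Lambda>L, of r] by linarith
    then have "L * r < L * R" using LR4 by linarith
    then have "r < R" using L by simp
    then show ?thesis using x(3) norm_triangle_ineq[of "y - x" "x - a"]
      by (simp add: r_def norm_minus_commute)
  qed
  obtain Ut P l where U: "((\<lambda>r. U x r) has_real_derivative Ut) (at s)" "has_jet2 (\<lambda>z. U z s) x P l"
    "Ut - l + (norm P)\<^sup>2 = (M * exp (- U x s)) powr (p - 1) * norm P powr p"
    using sU[of x s] x(3) R s unfolding log_hj_at_def by (auto simp: dist_norm norm_minus_commute)
  obtain Vt Q l' where V: "((\<lambda>r. U y r) has_real_derivative Vt) (at s)" "has_jet2 (\<lambda>z. U z s) y Q l'"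
    "Vt - l' + (norm Q)\<^sup>2 = (M * exp (- U y s)) powr (p - 1) * norm Q powr p"
    using sU[of y s] yR s unfolding log_hj_at_def by (auto simp: dist_norm norm_minus_commute)
  have Q: "norm Q = \<Lambda> x"
  proof -
    have xy: "x \<noteq> y" using r_pos by (auto simp: r_def)
    have "((\<lambda>z. \<Phi> x z s) has_derivative (\<lambda>v. - (Q \<bullet> v) - \<Lambda> x * (- v \<bullet> sgn (x - y)))) (at y)"
    proof -
      have "((\<lambda>z. x - z) has_derivative (\<lambda>v. - v)) (at y)"
        by (auto intro!: derivative_eq_intros)
      from has_derivative_compose[OF this has_derivative_norm] xy
      have "((\<lambda>z. norm (x - z)) has_derivative (\<lambda>v. - v \<bullet> sgn (x - y))) (at y)"
        by simp
      then show ?thesis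
        unfolding \<Phi>_def using has_jet2_imp_has_derivative[OF V(2)]
        by (auto intro!: derivative_eq_intros)
    qed
    moreover have "\<Phi> x z s \<le> \<Phi> x y s" if "z \<in> ball a (2 * R)" for z
      using that xys(1) by (intro xys(2)) (auto simp: D_def)
    ultimately have "(\<lambda>v. - (Q \<bullet> v) - \<Lambda> x * (- v \<bullet> sgn (x - y))) = (\<lambda>v. 0)"
      using differential_zero_maxmin[of y "ball a (2 * R)" "\<lambda>z. \<Phi> x z s"] yR
      by (auto simp: dist_norm norm_minus_commute)
    then have "(\<Lambda> x *\<^sub>R sgn (x - y) - Q) \<bullet> v = 0" for v
      by (drule_tac x = v in fun_cong) (simp add: inner_diff_left inner_commute[of "sgn (x - y)"])
    then have "Q = \<Lambda> x *\<^sub>R sgn (x - y)" by (metis eq_iff_diff_eq_0 inner_eq_zero_iff)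
    then show ?thesis using xy \<Lambda>0 by (simp add: norm_sgn)
  qed
  define G where "G = (L * q * w x ^ (q + 1) / R\<^sup>2) *\<^sub>R (2 *\<^sub>R (x - a))"
  define \<Delta> where "\<Delta> = L * q * (q + 1) * w x ^ (q + 2) / R ^ 4 * (2 * norm (x - a))\<^sup>2
    + L * q * w x ^ (q + 1) / R\<^sup>2 * (2 * CARD('n))"
  have j\<Lambda>: "has_jet2 \<Lambda> x G \<Delta>"
    using has_jet2_blowup_power[OF R x(3), of L q] unfolding G_def \<Delta>_def w_def \<Lambda>_def .
  define \<Psi> where "\<Psi> z = U (x + z) s - U (y + z) s - r * \<Lambda> (x + z)" for z
  have \<Psi>: "\<Psi> z = \<Phi> (x + z) (y + z) s - \<eta> * (s - t0)" for z
    by (simp add: \<Psi>_def \<Phi>_def r_def)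
  have j: "has_jet2 \<Psi> 0 (P - Q - r *\<^sub>R G) (l - l' - r * \<Delta>)"
    unfolding \<Psi>_def
    by (intro has_jet2_diff has_jet2_cmult has_jet2_translate) (use U V j\<Lambda> in auto)
  have "\<forall>\<^sub>F z in nhds 0. z \<in> ball 0 (min (R' - norm (x - a)) (2 * R - norm (y - a)))"
    by (rule eventually_nhds_in_open) (use xR' yR in auto)
  then have "\<forall>\<^sub>F z in nhds 0. \<Psi> z \<le> \<Psi> 0"
  proof eventually_elim
    case (elim z)
    have "norm (x + z - a) \<le> R'" "norm (y + z - a) \<le> 2 * R"
      using elim norm_triangle_ineq[of "x - a" z] norm_triangle_ineq[of "y - a" z]
      by (auto simp: algebra_simps)
    then have "(x + z, y + z, s) \<in> D"
      using s by (auto simp: D_def dist_norm norm_minus_commute)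
    then show ?case using xys(2) by (simp add: \<Psi>)
  qed
  from has_jet2_local_max[OF j this]
  have P: "P = Q + r *\<^sub>R G" and l0: "l - l' - r * \<Delta> \<le> 0" by (auto simp: algebra_simps)
  have "((\<lambda>s. \<Phi> x y s) has_real_derivative Ut - Vt + \<eta>) (at s)"
    unfolding \<Phi>_def using U(1) V(1) by (auto intro!: derivative_eq_intros)
  then have time0: "0 \<le> Ut - Vt + \<eta>"
    by (rule derivative_nonneg_of_left_max[OF _ s(2)]) (use xys x y s in \<open>auto simp: D_def\<close>)
  define d where "d = norm G"
  define \<kappa> where "\<kappa> = (M * exp (- U x s)) powr (p - 1)"
  have \<kappa>: "M powr (p - 1) \<le> \<kappa>" using bU[OF x(2) s(1)] M p by (auto simp: \<kappa>_def intro!: powr_mono2)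
  have d: "d \<le> 2 * q * L * w x ^ (q + 1) / R"
  proof -
    have "d = L * q * w x ^ (q + 1) / R\<^sup>2 * (2 * norm (x - a))" using L w by (simp add: d_def G_def)
    also have "\<dots> \<le> L * q * w x ^ (q + 1) / R\<^sup>2 * (2 * R)"
      using L w x(3) by (intro mult_left_mono) auto
    finally show ?thesis using R by (simp add: power2_eq_square mult_ac)
  qed
  have \<Delta>: "\<Delta> \<le> 2 * q * (CARD('n) + 2 * q + 2) * L * w x ^ (q + 2) / R\<^sup>2"
  proof -
    have "L * q * (q + 1) * w x ^ (q + 2) / R ^ 4 * (2 * norm (x - a))\<^sup>2
      \<le> L * q * (q + 1) * w x ^ (q + 2) / R ^ 4 * (2 * R)\<^sup>2"
      using L w x(3) by (intro mult_left_mono power_mono) auto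
    also have "\<dots> = 4 * (L * q * (q + 1) * w x ^ (q + 2)) / R\<^sup>2"
      using R by (simp add: power2_eq_square power4_eq_xxxx)
    also have "4 * (L * q * (q + 1) * w x ^ (q + 2)) = 2 * q * (2 * q + 2) * L * w x ^ (q + 2)"
      by (simp add: algebra_simps)
    finally have 1: "L * q * (q + 1) * w x ^ (q + 2) / R ^ 4 * (2 * norm (x - a))\<^sup>2
      \<le> 2 * q * (2 * q + 2) * L * w x ^ (q + 2) / R\<^sup>2" .
    have "L * q * w x ^ (q + 1) / R\<^sup>2 * (2 * CARD('n)) \<le> L * q * w x ^ (q + 2) / R\<^sup>2 * (2 * CARD('n))"
      using L w by (intro mult_right_mono divide_right_mono mult_left_mono power_increasing) auto
    also have "\<dots> = 2 * q * CARD('n) * L * w x ^ (q + 2) / R\<^sup>2" by simp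
    finally have 2: "L * q * w x ^ (q + 1) / R\<^sup>2 * (2 * CARD('n)) \<le> 2 * q * CARD('n) * L * w x ^ (q + 2) / R\<^sup>2" .
    have "2 * q * (2 * q + 2) * L * w x ^ (q + 2) / R\<^sup>2 + 2 * q * CARD('n) * L * w x ^ (q + 2) / R\<^sup>2
       = 2 * q * (CARD('n) + 2 * q + 2) * L * w x ^ (q + 2) / R\<^sup>2"
      by (simp add: add_divide_distrib[symmetric] algebra_simps)
    then show ?thesis using 1 2 unfolding \<Delta>_def by linarith
  qed
  \<comment> \<open>The increment of the gradient does not exceed the gradient itself, so
    \<open>\<Lambda> x + r * d\<close> may be replaced by \<open>2 * \<Lambda> x\<close>; this is
    the source of \<open>2 powr (p - 1)\<close> in the barrier inequality.\<close>
  have rd: "r * d \<le> \<Lambda> x"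
  proof -
    have "r * d \<le> r * (2 * q * L * w x ^ (q + 1) / R)" using d r_pos by (intro mult_left_mono) auto
    also have "\<dots> = (L * w x * r) * (2 * real q) * w x ^ q / R" by simp
    also have "\<dots> \<le> 2 * (2 * real q) * w x ^ q / R"
      by (rule divide_right_mono[OF mult_right_mono[OF mult_right_mono[OF Lwr]]]) (use w R in auto)
    also have "\<dots> = (4 * q) * w x ^ q / R" by simp
    also have "\<dots> \<le> (L * R) * w x ^ q / R"
      using c1 w R by (intro divide_right_mono mult_right_mono) auto
    finally show ?thesis using R by (simp add: \<Lambda>_def)
  qed
  have bar: "\<Delta> + 2 * \<Lambda> x * d + \<kappa> * (p * 2 powr (p - 1) * \<Lambda> x powr (p - 1) * d) \<le> (p - 1) * \<kappa> * \<Lambda> x * \<Lambda> x powr p"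
    by (rule blowup_barrier[OF p M R L q c1 c2 _ _ w \<Lambda>_def _ d _ \<kappa>, of "CARD('n)"])
      (use c3 \<Delta> in \<open>simp_all add: d_def algebra_simps\<close>)
  \<comment> \<open>The barrier inequality times \<open>r\<close> cancels every term proportional to
    \<open>r\<close>. What survives is the gain from \<open>m\<close>, at least
    \<open>2 * \<eta>\<close>, against the time slope \<open>\<eta>\<close>.\<close>
  have "r * \<Delta> + 2 * \<Lambda> x * (r * d) + \<kappa> * (p * (r * d) * (2 powr (p - 1) * \<Lambda> x powr (p - 1)))
      \<le> (p - 1) * \<kappa> * (\<Lambda> x * r) * \<Lambda> x powr p"
    using mult_left_mono[OF bar, of r] r_pos by (simp add: algebra_simps)
  moreover have "\<kappa> * (p * (r * d) * (\<Lambda> x + r * d) powr (p - 1))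
    \<le> \<kappa> * (p * (r * d) * (2 powr (p - 1) * \<Lambda> x powr (p - 1)))"
  proof -
    have "(\<Lambda> x + r * d) powr (p - 1) \<le> (2 * \<Lambda> x) powr (p - 1)"
      using rd \<Lambda>0 r_pos p by (intro powr_mono2) (auto simp: d_def)
    then show ?thesis
      using p r_pos by (intro mult_left_mono) (auto simp: powr_mult d_def \<kappa>_def)
  qed
  moreover have "- \<eta> - r * \<Delta> \<le> 2 * \<Lambda> x * (r * d) + \<kappa> * (p * (r * d) * (\<Lambda> x + r * d) powr (p - 1))
     - \<kappa> * (p - 1) * (\<Lambda> x * r + m) * \<Lambda> x powr p"
  proof -
    have "0 \<le> \<Lambda> x * r + m" using \<Lambda>0 r_pos m by simp
    from log_hj_gradient_difference[OF p M P this gap]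
    have "- (norm P)\<^sup>2 + (M * exp (- U x s)) powr (p - 1) * norm P powr p
      - (- (norm Q)\<^sup>2 + (M * exp (- U y s)) powr (p - 1) * norm Q powr p)
      \<le> 2 * \<Lambda> x * (r * d) + \<kappa> * (p * (r * d) * (\<Lambda> x + r * d) powr (p - 1))
        - \<kappa> * (p - 1) * (\<Lambda> x * r + m) * \<Lambda> x powr p"
      using r_pos by (simp add: Q \<kappa>_def d_def)
    then show ?thesis using U(3) V(3) time0 l0 by linarith
  qed
  moreover have "\<kappa> * (p - 1) * (\<Lambda> x * r + m) * \<Lambda> x powr p
     = (p - 1) * \<kappa> * (\<Lambda> x * r) * \<Lambda> x powr p + (p - 1) * \<kappa> * \<Lambda> x powr p * m"
    by (simp add: algebra_simps)
  moreover have "(p - 1) * M powr (p - 1) * L powr p * m \<le> (p - 1) * \<kappa> * \<Lambda> x powr p * m"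
    using p M L m \<kappa> \<Lambda>L order_trans[OF _ \<kappa>, of 0] by (intro mult_right_mono mult_mono powr_mono2) auto
  ultimately show False using \<eta>2 \<eta> by linarith
qed

subsection \<open>Behaviour far from the boundary\<close>

lemma log_transform_bounds:
  fixes M v :: real
  assumes "M > 0" "\<bar>v\<bar> \<le> M"
  shows "- 2 \<le> - ln (2 - v / M)" "- ln (2 - v / M) \<le> 0"
proof -
  have "1 \<le> 2 - v / M" "2 - v / M \<le> 3" using assms by (auto simp: field_simps)
  then show "- 2 \<le> - ln (2 - v / M)" "- ln (2 - v / M) \<le> 0"
    using ln_le_minus_one[of "2 - v / M"] by auto
qed

lemma log_transform_difference_le:
  fixes M v v' :: real
  assumes M: "M > 0" and v: "\<bar>v\<bar> \<le> M" "\<bar>v'\<bar> \<le> M" and D: "0 \<le> D" "v - v' \<le> M * D"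
  shows "- ln (2 - v / M) - (- ln (2 - v' / M)) \<le> D"
proof -
  define a b where "a = 2 - v / M" and "b = 2 - v' / M"
  have ab: "a \<ge> 1" "b \<ge> 1" using M v by (auto simp: a_def b_def field_simps)
  have "b - a = (v - v') / M" by (simp add: a_def b_def diff_divide_distrib)
  then have d: "b - a \<le> D" using D M by (simp add: divide_le_eq mult.commute)
  have "ln (b / a) \<le> b / a - 1" using ab by (intro ln_le_minus_one) auto
  also have "\<dots> = (b - a) / a" using ab by (simp add: diff_divide_distrib)
  also have "\<dots> \<le> D / 1"
    using d ab D by (intro frac_le) auto
  finally have "ln b - ln a \<le> D" using ab by (simp add: ln_div)
  then show ?thesis by (simp add: a_def b_def)
qed

text \<open>The inverse of the transform has Lipschitz constant \<open>3 * M\<close>, because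
  \<open>2 - v' / M\<close> is at most 3.\<close>

lemma difference_le_of_log_transform:
  fixes M v v' :: real
  assumes M: "M > 0" and v: "\<bar>v\<bar> \<le> M" "\<bar>v'\<bar> \<le> M"
    and D: "0 \<le> D" "- ln (2 - v / M) - (- ln (2 - v' / M)) \<le> D"
  shows "v - v' \<le> 3 * M * D"
proof -
  define a b where "a = 2 - v / M" and "b = 2 - v' / M"
  have ab: "a \<ge> 1" "b \<ge> 1" "b \<le> 3" using M v by (auto simp: a_def b_def field_simps)
  have "ln (a / b) \<le> a / b - 1" using ab by (intro ln_le_minus_one) auto
  then have "1 - a / b \<le> ln b - ln a" using ab by (simp add: ln_div)
  also have "\<dots> \<le> D" using D by (simp add: a_def b_def)
  finally have "1 - a / b \<le> D" .
  then have "b - a \<le> b * D" using ab by (simp add: field_simps)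
  also have "\<dots> \<le> 3 * D" using ab D by (intro mult_right_mono) auto
  finally have "M * (b - a) \<le> M * (3 * D)" using M by (intro mult_left_mono) auto
  moreover have "M * (b - a) = v - v'" using M by (simp add: a_def b_def field_simps)
  ultimately show ?thesis by (simp add: mult_ac)
qed

lemma continuous_on_log_transform:
  assumes "continuous_on S f" "M > 0" "\<And>z. z \<in> S \<Longrightarrow> \<bar>f z\<bar> \<le> (M :: real)"
  shows "continuous_on S (\<lambda>z. - ln (2 - f z / M))"
proof -
  have "2 - f z / M \<noteq> 0" if "z \<in> S" for z
    using assms(3)[OF that] assms(2) by (auto simp: field_simps)
  then show ?thesis using assms(1,2) by (auto intro!: continuous_intros)
qed

text \<open>The Lipschitz estimate is applied on the ball of radius \<open>2 * R\<close> around
  \<open>a\<close> with \<open>R = a $ k / 3\<close>, which stays between heights \<open>R\<close>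
  and \<open>5 * R\<close>. The choice \<open>L = \<delta> / (3 * M)\<close> makes the slope exactly
  \<open>\<delta>\<close> once the logarithm is undone.\<close>

lemma hj_spatial_difference_small:
  fixes u :: "real^'n \<Rightarrow> real \<Rightarrow> real"
  assumes p: "p > 1"
    and sol: "\<And>x t. 0 < x $ k \<Longrightarrow> t \<le> t0 \<Longrightarrow> hj_at p u x t"
    and cont: "continuous_on ({x. 0 \<le> x $ k} \<times> {..t0}) (\<lambda>(x, t). u x t)"
    and growth: "\<And>c. c > 0 \<Longrightarrow> \<exists>K. \<forall>x t. 0 \<le> x $ k \<longrightarrow> t \<le> t0 \<longrightarrow> \<bar>u x t\<bar> \<le> K + c * x $ k"
    and \<delta>: "\<delta> > 0"
  shows "\<exists>X. \<forall>a b t. X \<le> a $ k \<longrightarrow> norm (a - b) \<le> Y \<longrightarrow> t \<le> t0 \<longrightarrow> u a t - u b t \<le> \<delta> * norm (a - b)"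
proof -
  \<comment> \<open>\<open>q + 1 \<le> p * q\<close> amounts to
    \<open>q \<ge> 1 / (p - 1)\<close>.\<close>
  obtain j :: nat where j: "1 / (p - 1) \<le> j" using real_arch_simple by blast
  define q where "q = max 1 j"
  have q: "q \<ge> 1" "q + 1 \<le> p * q"
  proof -
    have "1 / (p - 1) \<le> q" using j by (simp add: q_def)
    then show "q + 1 \<le> p * q" using p by (simp add: field_simps)
  qed (simp add: q_def)
  \<comment> \<open>The estimate needs \<open>L * R \<ge> B\<close> for its first two conditions and
    \<open>R \<ge> C\<close> for the third, where \<open>M * L = \<delta> / 3\<close> is constant.
    As \<open>M = K + \<delta> * R / (6 * B)\<close>, the growth slope
    \<open>\<delta> / (30 * B)\<close> turns \<open>L * R \<ge> B\<close> into
    \<open>6 * B * K \<le> \<delta> * R\<close>.\<close>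
  define B where "B = 4 * q + p * 2 powr (p + 1) * q / (p - 1)"
  define C where "C = 16 * q * (CARD('n) + 2 * q + 2) / ((p - 1) * (\<delta> / 3) powr (p - 1))"
  have B: "B > 0" using q p by (auto simp: B_def intro!: add_pos_nonneg)
  have C: "C \<ge> 0" using p by (simp add: C_def)
  have "\<delta> / (30 * B) > 0" using \<delta> B by simp
  from growth[OF this] obtain K0 where K0:
    "\<And>x t. 0 \<le> x $ k \<Longrightarrow> t \<le> t0 \<Longrightarrow> \<bar>u x t\<bar> \<le> K0 + \<delta> / (30 * B) * x $ k" by blast
  define K where "K = \<bar>K0\<bar> + 1"
  have K: "K > 0" by (simp add: K_def)
  define R0 where "R0 = 6 * B * K / \<delta> + C + \<bar>Y\<bar> + 1"
  have R0: "6 * B * K / \<delta> \<le> R0" "C \<le> R0" "\<bar>Y\<bar> \<le> R0" "1 \<le> R0"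
    using B K \<delta> C by (auto simp: R0_def)
  have "u a t - u b t \<le> \<delta> * norm (a - b)" if a: "3 * R0 \<le> a $ k" and b: "norm (a - b) \<le> Y" and t: "t \<le> t0"
    for a b t
  proof -
    define R where "R = a $ k / 3"
    have R: "R0 \<le> R" "R > 0" using a R0 by (auto simp: R_def)
    define M where "M = K + \<delta> / (30 * B) * (5 * R)"
    have M: "M > 0" using K \<delta> B R by (simp add: M_def add_pos_pos)
    define L where "L = \<delta> / (3 * M)"
    have L: "L > 0" using \<delta> M by (simp add: L_def)
    have LR: "B \<le> L * R"
    proof -
      have "6 * B * K / \<delta> \<le> R" using R0 R by linarith
      then have "6 * B * K \<le> \<delta> * R" using \<delta> by (simp add: field_simps)
      then have "3 * M * B \<le> \<delta> * R" using B by (simp add: M_def field_simps)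
      then show ?thesis using M by (simp add: L_def field_simps)
    qed
    have c1: "4 * q \<le> L * R"
    proof -
      have "0 \<le> p * 2 powr (p + 1) * q / (p - 1)" using p by simp
      then show ?thesis using LR by (simp add: B_def)
    qed
    have c2: "p * 2 powr (p + 1) * q \<le> (p - 1) * (L * R)"
    proof -
      have "p * 2 powr (p + 1) * q / (p - 1) \<le> L * R" using LR by (simp add: B_def)
      then show ?thesis using p by (simp add: field_simps)
    qed
    have c3: "16 * q * (CARD('n) + 2 * q + 2) \<le> (p - 1) * ((M * L) powr (p - 1) * R)"
    proof -
      have "C \<le> R" using R0 R by linarith
      then have "16 * q * (CARD('n) + 2 * q + 2) \<le> R * ((p - 1) * (\<delta> / 3) powr (p - 1))"
        using p \<delta> by (simp add: C_def divide_le_eq)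
      moreover have eq: "M * L = \<delta> / 3" using M by (simp add: L_def)
      ultimately show ?thesis unfolding eq by (simp add: mult_ac)
    qed
    have height: "R \<le> x $ k" "x $ k \<le> 5 * R" if "x \<in> cball a (2 * R)" for x
      using component_le_norm_cart[of "x - a" k] that
      by (auto simp: R_def dist_norm norm_minus_commute)
    have uM: "\<bar>u x s\<bar> \<le> M" if "x \<in> cball a (2 * R)" "s \<le> t0" for x s
    proof -
      have "\<bar>u x s\<bar> \<le> K0 + \<delta> / (30 * B) * x $ k" using K0 height(1)[OF that(1)] R that(2) by simp
      also have "\<dots> \<le> M" unfolding M_def K_def
        using height(2)[OF that(1)] \<delta> B by (intro add_mono mult_left_mono) auto
      finally show ?thesis .
    qed
    have b': "b \<in> cball a (2 * R)" using b R R0 by (simp add: dist_norm)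
    have a': "a \<in> cball a (2 * R)" using R by simp
    have sub: "cball a (2 * R) \<times> {..t0} \<subseteq> {x. 0 \<le> x $ k} \<times> {..t0}"
      using height R by fastforce
    have "- ln (2 - u a t / M) - (- ln (2 - u b t / M)) \<le> L * norm (a - b)"
    proof (rule log_hj_lipschitz[OF p M R(2) L q c1 c2 c3 _ _ _ b' t, of "\<lambda>x t. - ln (2 - u x t / M)"])
      show "continuous_on (cball a (2 * R) \<times> {..t0}) (\<lambda>(x, t). - ln (2 - u x t / M))"
        using continuous_on_log_transform[OF continuous_on_subset[OF cont sub] M] uM
        by (auto simp: case_prod_beta)
      show "- 2 \<le> - ln (2 - u x t / M) \<and> - ln (2 - u x t / M) \<le> 0" if "x \<in> cball a (2 * R)" "t \<le> t0" for x t
        using log_transform_bounds[OF M uM[OF that]] by blast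
      show "log_hj_at p M (\<lambda>x t. - ln (2 - u x t / M)) x t" if "x \<in> ball a (2 * R)" "t \<le> t0" for x t
      proof (rule log_hj_at_of_hj_at[OF _ M])
        have "x \<in> cball a (2 * R)" using that by simp
        then show "\<bar>u x t\<bar> \<le> M" "hj_at p u x t" using uM sol[of x t] height(1)[of x] R that by auto
      qed
    qed
    from difference_le_of_log_transform[OF M uM[OF a' t] uM[OF b' t] _ this] L
    have "u a t - u b t \<le> 3 * M * (L * norm (a - b))" by simp
    also have "\<dots> = \<delta> * norm (a - b)" using M by (simp add: L_def)
    finally show ?thesis .
  qed
  then show ?thesis by blast
qed

text \<open>Compare with \<open>u a t1 + \<delta> + K (t - t1) + 2 \<delta> \<bar>x - a\<bar>\<^sup>2\<close>: by the Lipschitz bound at \<open>a\<close> the difference cannot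
  have its maximum on the sphere.\<close>

lemma hj_time_difference:
  fixes u :: "real^'n \<Rightarrow> real \<Rightarrow> real" and \<delta> :: real
  assumes p: "p > 1" and \<delta>: "\<delta> > 0" and t: "t1 \<le> t2"
    and sol: "\<And>x t. x \<in> ball a 1 \<Longrightarrow> t1 \<le> t \<Longrightarrow> t \<le> t2 \<Longrightarrow> hj_at p u x t"
    and cont: "continuous_on (cball a 1 \<times> {t1..t2}) (\<lambda>(x, t). u x t)"
    and lip: "\<And>x t. x \<in> cball a 1 \<Longrightarrow> t1 \<le> t \<Longrightarrow> t \<le> t2 \<Longrightarrow> \<bar>u x t - u a t\<bar> \<le> \<delta> * norm (x - a)"
  shows "\<bar>u a t2 - u a t1\<bar> \<le> \<delta> + (4 * CARD('n) * \<delta> + (4 * \<delta>) powr p + \<delta>) * (t2 - t1)"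
proof -
  \<comment> \<open>At a maximum later than \<open>t1\<close> the slope \<open>K\<close> could be at
    most the Laplacian bound \<open>4 * CARD('n) * \<delta>\<close> plus the gradient bound
    \<open>(4 * \<delta>) powr p\<close>. The extra \<open>\<delta>\<close> makes this impossible,
    so the maximum is at time \<open>t1\<close>.\<close>
  define K where "K = 4 * CARD('n) * \<delta> + (4 * \<delta>) powr p + \<delta>"
  have K: "K > 0" using \<delta> by (auto simp: K_def intro!: add_nonneg_pos)
  \<comment> \<open>Both signs are treated at once: for \<open>\<sigma> = - 1\<close> the gradient
    term is nonpositive, so the same upper bound holds.\<close>
  have main: "\<sigma> * (u a t2 - u a t1) \<le> \<delta> + K * (t2 - t1)" if \<sigma>: "\<sigma> = 1 \<or> \<sigma> = - 1" for \<sigma> :: real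
  proof -
    define \<Phi> where "\<Phi> x s = \<sigma> * u x s - K * (s - t1) - 2 * \<delta> * (norm (x - a))\<^sup>2" for x s
    have "continuous_on (cball a 1 \<times> {t1..t2}) (\<lambda>z. \<Phi> (fst z) (snd z))"
      using cont unfolding \<Phi>_def by (auto simp: case_prod_beta intro!: continuous_intros)
    moreover have "compact (cball a 1 \<times> {t1..t2})" by (intro compact_Times) auto
    moreover have "cball a 1 \<times> {t1..t2} \<noteq> {}" using t by auto
    ultimately obtain x s where xs: "x \<in> cball a 1" "s \<in> {t1..t2}"
      and mx: "\<And>x' s'. x' \<in> cball a 1 \<Longrightarrow> s' \<in> {t1..t2} \<Longrightarrow> \<Phi> x' s' \<le> \<Phi> x s"
      using continuous_attains_sup[of "cball a 1 \<times> {t1..t2}" "\<lambda>z. \<Phi> (fst z) (snd z)"] by fastforce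
    have lip': "\<sigma> * u x s \<le> \<sigma> * u a s + \<delta> * norm (x - a)"
      using lip[of x s] xs \<sigma> by auto
    have n1: "norm (x - a) < 1"
    proof (rule ccontr)
      assume "\<not> norm (x - a) < 1"
      then have "norm (x - a) = 1" using xs by (simp add: dist_norm norm_minus_commute)
      then show False using mx[of a s] xs lip' \<delta> by (simp add: \<Phi>_def)
    qed
    have "s = t1"
    proof (rule ccontr)
      assume "s \<noteq> t1"
      then have s: "t1 < s" "s \<le> t2" using xs by auto
      obtain ut g l where U: "((\<lambda>r. u x r) has_real_derivative ut) (at s)" "has_jet2 (\<lambda>y. u y s) x g l"
        "ut - l = norm g powr p"
        using sol[of x s] n1 s unfolding hj_at_def by (auto simp: dist_norm norm_minus_commute)
      have cst: "has_jet2 (\<lambda>y. K * (s - t1)) x 0 0"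
        by (rule has_jet2I[where G = "\<lambda>_. 0" and h = "\<lambda>_. 0"]) auto
      have j: "has_jet2 (\<lambda>y. \<Phi> y s) x (\<sigma> *\<^sub>R g - (2 * \<delta>) *\<^sub>R (2 *\<^sub>R (x - a))) (\<sigma> * l - 2 * \<delta> * (2 * CARD('n)))"
        using has_jet2_diff[OF has_jet2_diff[OF has_jet2_cmult[OF U(2), of \<sigma>] cst]
            has_jet2_cmult[OF has_jet2_norm_square[of a x], of "2 * \<delta>"]]
        by (simp add: \<Phi>_def[abs_def])
      have "\<forall>\<^sub>F y in nhds x. y \<in> ball a 1"
        using n1 by (intro eventually_nhds_in_open) (auto simp: dist_norm norm_minus_commute)
      then have "\<forall>\<^sub>F y in nhds x. \<Phi> y s \<le> \<Phi> x s"
        by eventually_elim (use mx xs in auto)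
      from has_jet2_local_max[OF j this]
      have g: "\<sigma> *\<^sub>R g = (4 * \<delta>) *\<^sub>R (x - a)" and l: "\<sigma> * l \<le> 4 * CARD('n) * \<delta>" by (auto simp: mult.commute[of \<delta>])
      have "((\<lambda>r. \<Phi> x r) has_real_derivative \<sigma> * ut - K) (at s)"
        unfolding \<Phi>_def using U(1) by (auto intro!: derivative_eq_intros)
      then have ut: "0 \<le> \<sigma> * ut - K"
        by (rule derivative_nonneg_of_left_max[OF _ s(1)]) (use mx xs in auto)
      have "norm g = norm (\<sigma> *\<^sub>R g)" using \<sigma> by auto
      also have "\<dots> \<le> 4 * \<delta>" using g n1 \<delta> by simp
      finally have "norm g powr p \<le> (4 * \<delta>) powr p" using p by (intro powr_mono2) auto
      then have "\<sigma> * (ut - l) \<le> (4 * \<delta>) powr p"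
      proof -
        have "0 \<le> norm g powr p" by simp
        then have "\<sigma> * norm g powr p \<le> norm g powr p" using \<sigma> by (elim disjE) simp_all
        then show ?thesis using \<open>norm g powr p \<le> (4 * \<delta>) powr p\<close> unfolding U(3) by linarith
      qed
      moreover have "\<sigma> * (ut - l) = \<sigma> * ut - \<sigma> * l" by (simp add: right_diff_distrib)
      ultimately show False using ut l \<delta> by (simp add: K_def)
    qed
    have "\<Phi> a t2 \<le> \<Phi> x t1" using mx[of a t2] t \<open>s = t1\<close> by simp
    moreover have "\<delta> * norm (x - a) \<le> \<delta> * 1" using n1 \<delta> by (intro mult_left_mono) auto
    moreover have "0 \<le> 2 * \<delta> * (norm (x - a))\<^sup>2" using \<delta> by simp
    ultimately show ?thesis using lip' \<open>s = t1\<close> by (simp add: \<Phi>_def right_diff_distrib)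
  qed
  show ?thesis using main[of 1] main[of "-1"] by (simp add: K_def abs_le_iff)
qed

subsection \<open>Translation invariance\<close>

text \<open>The strip is cut at a height \<open>X\<close> above which
  \<open>u - v \<le> e / 3\<close>. There both functions are bounded by one \<open>M\<close>, and
  the strip comparison of their transforms with \<open>\<mu> = e / (3 * M)\<close> loses a factor
  \<open>3 * M\<close> when the logarithm is undone.\<close>

lemma hj_comparison_halfspace:
  fixes u v :: "real^'n \<Rightarrow> real \<Rightarrow> real"
  assumes p: "p > 1"
    and solu: "\<And>x t. 0 < x $ k \<Longrightarrow> t \<le> t0 \<Longrightarrow> hj_at p u x t"
    and solv: "\<And>x t. 0 < x $ k \<Longrightarrow> t \<le> t0 \<Longrightarrow> hj_at p v x t"
    and contu: "continuous_on ({x. 0 \<le> x $ k} \<times> {..t0}) (\<lambda>(x, t). u x t)"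
    and contv: "continuous_on ({x. 0 \<le> x $ k} \<times> {..t0}) (\<lambda>(x, t). v x t)"
    and bu: "\<And>X. \<exists>M. \<forall>x t. 0 \<le> x $ k \<longrightarrow> x $ k \<le> X \<longrightarrow> t \<le> t0 \<longrightarrow> \<bar>u x t\<bar> \<le> M"
    and bv: "\<And>X. \<exists>M. \<forall>x t. 0 \<le> x $ k \<longrightarrow> x $ k \<le> X \<longrightarrow> t \<le> t0 \<longrightarrow> \<bar>v x t\<bar> \<le> M"
    and bd: "\<And>x t. x $ k = 0 \<Longrightarrow> t \<le> t0 \<Longrightarrow> u x t \<le> v x t"
    and decay: "\<And>\<delta>. \<delta> > 0 \<Longrightarrow> \<exists>X. \<forall>x t. X \<le> x $ k \<longrightarrow> t \<le> t0 \<longrightarrow> u x t - v x t \<le> \<delta>"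
    and x: "0 \<le> x $ k" "t \<le> t0"
  shows "u x t \<le> v x t"
proof (rule field_le_epsilon)
  fix e :: real
  assume e: "e > 0"
  then obtain X0 where X0: "\<And>x t. X0 \<le> x $ k \<Longrightarrow> t \<le> t0 \<Longrightarrow> u x t - v x t \<le> e / 3"
    using decay[of "e / 3"] by auto
  define X where "X = max X0 (x $ k)"
  have X: "0 \<le> X" "X0 \<le> X" "x $ k \<le> X" using x(1) by (auto simp: X_def)
  obtain M1 M2 where M1: "\<And>(x::real^'n) t. 0 \<le> x $ k \<Longrightarrow> x $ k \<le> X \<Longrightarrow> t \<le> t0 \<Longrightarrow> \<bar>u x t\<bar> \<le> M1"
    and M2: "\<And>(x::real^'n) t. 0 \<le> x $ k \<Longrightarrow> x $ k \<le> X \<Longrightarrow> t \<le> t0 \<Longrightarrow> \<bar>v x t\<bar> \<le> M2"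
    using bu[of X] bv[of X] by blast
  define M where "M = max 1 (max M1 M2)"
  have M: "M > 0" by (simp add: M_def)
  have uM: "\<bar>u x t\<bar> \<le> M" "\<bar>v x t\<bar> \<le> M" if "0 \<le> x $ k" "x $ k \<le> X" "t \<le> t0" for x :: "real^'n" and t
    using M1[OF that] M2[OF that] by (auto simp: M_def)
  have sub: "{x::real^'n. 0 \<le> x $ k \<and> x $ k \<le> X} \<times> {..t0} \<subseteq> {x. 0 \<le> x $ k} \<times> {..t0}" by auto
  have "- ln (2 - u x t / M) - (- ln (2 - v x t / M)) \<le> e / (3 * M)"
  proof (rule log_hj_comparison[OF p M, of k X t0 "\<lambda>x t. - ln (2 - u x t / M)" "\<lambda>x t. - ln (2 - v x t / M)"])
    show "continuous_on ({x. 0 \<le> x $ k \<and> x $ k \<le> X} \<times> {..t0}) (\<lambda>(x, t). - ln (2 - u x t / M))"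
      using continuous_on_log_transform[OF continuous_on_subset[OF contu sub] M] uM
      by (auto simp: case_prod_beta)
    show "continuous_on ({x. 0 \<le> x $ k \<and> x $ k \<le> X} \<times> {..t0}) (\<lambda>(x, t). - ln (2 - v x t / M))"
      using continuous_on_log_transform[OF continuous_on_subset[OF contv sub] M] uM
      by (auto simp: case_prod_beta)
  next
    fix x :: "real^'n" and t
    assume xt: "0 \<le> x $ k" "x $ k \<le> X" "t \<le> t0"
    show "- 2 \<le> - ln (2 - u x t / M) \<and> - ln (2 - u x t / M) \<le> 0"
      using log_transform_bounds[OF M uM(1)[OF xt]] by blast
    show "- 2 \<le> - ln (2 - v x t / M) \<and> - ln (2 - v x t / M) \<le> 0"
      using log_transform_bounds[OF M uM(2)[OF xt]] by blast
  next
    fix x :: "real^'n" and t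
    assume xt: "0 < x $ k" "x $ k < X" "t \<le> t0"
    show "log_hj_at p M (\<lambda>x t. - ln (2 - u x t / M)) x t"
      using xt by (intro log_hj_at_of_hj_at solu uM M) auto
    show "log_hj_at p M (\<lambda>x t. - ln (2 - v x t / M)) x t"
      using xt by (intro log_hj_at_of_hj_at solv uM M) auto
  next
    fix x :: "real^'n" and t
    assume xt: "x $ k = 0" "t \<le> t0"
    have "- ln (2 - u x t / M) - (- ln (2 - v x t / M)) \<le> 0"
      using xt X bd[OF xt] by (intro log_transform_difference_le uM M) auto
    then show "- ln (2 - u x t / M) \<le> - ln (2 - v x t / M)" by simp
  next
    fix x :: "real^'n" and t
    assume xt: "x $ k = X" "t \<le> t0"
    have "0 \<le> X" "X0 \<le> X" using X by auto
    then show "- ln (2 - u x t / M) - (- ln (2 - v x t / M)) \<le> e / (3 * M)"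
      using xt X0[of x t] e M by (intro log_transform_difference_le uM M) auto
  qed (use e M x in \<open>auto simp: X_def\<close>)
  from difference_le_of_log_transform[OF M uM(1) uM(2) _ this]
  have "u x t - v x t \<le> 3 * M * (e / (3 * M))"
    using x e M by (auto simp: X_def)
  then show "u x t \<le> v x t + e" using M by simp
qed

section \<open>Translates of an ancient solution\<close>

lemma hj_at_translate:
  assumes "hj_at p u (h + x) (t - \<sigma>)"
  shows "hj_at p (\<lambda>x t. u (h + x) (t - \<sigma>)) x t"
proof -
  obtain ut g l where U: "((\<lambda>s. u (h + x) s) has_real_derivative ut) (at (t - \<sigma>))"
    "has_jet2 (\<lambda>y. u y (t - \<sigma>)) (h + x) g l" "ut - l = norm g powr p"
    using assms unfolding hj_at_def by blast
  have "((\<lambda>s. s - \<sigma>) has_real_derivative 1) (at t)" by (auto intro!: derivative_eq_intros)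
  from DERIV_chain2[OF U(1) this] has_jet2_translate[OF U(2)] U(3)
  show ?thesis unfolding hj_at_def by auto
qed

lemma ancient_solution_hj_at:
  assumes "ancient_solution_halfspace k p u" "0 < x $ k" "t < 0"
  shows "hj_at p u x t"
proof -
  obtain ut gu hu where H: "\<forall>(x, t) \<in> halfspace_Q k.
           ((\<lambda>s. u x s) has_real_derivative ut x t) (at t) \<and>
           ((\<lambda>y. u y t) has_derivative (\<lambda>h. gu x t \<bullet> h)) (at x) \<and>
           ((\<lambda>y. gu y t) has_derivative (\<lambda>h. hu x t *v h)) (at x) \<and>
           ut x t - (\<Sum>i\<in>UNIV. hu x t $ i $ i) = norm (gu x t) powr p"
    using assms(1) unfolding ancient_solution_halfspace_def by blast
  have Q: "(y, t) \<in> halfspace_Q k" if "0 < y $ k" for y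
    using that assms(3) by (simp add: halfspace_Q_def)
  have "has_jet2 (\<lambda>y. u y t) x (gu x t) (\<Sum>i\<in>UNIV. hu x t $ i $ i)"
  proof (rule has_jet2I[where G = "\<lambda>y. gu y t" and h = "\<lambda>i. hu x t $ i $ i"])
    have "open {y::real^'a. 0 < y $ k}" by (intro open_Collect_less continuous_intros)
    then have "\<forall>\<^sub>F y in nhds x. y \<in> {y. 0 < y $ k}"
      using assms(2) by (intro eventually_nhds_in_open) auto
    then show "\<forall>\<^sub>F y in nhds x. ((\<lambda>y. u y t) has_derivative (\<lambda>v. gu y t \<bullet> v)) (at y)"
    proof eventually_elim
      case (elim y)
      then show ?case using bspec[OF H Q[of y]] by auto
    qed
    fix i
    have 1: "((\<lambda>s. x + s *\<^sub>R axis i 1) has_derivative (\<lambda>s. s *\<^sub>R axis i 1)) (at 0)"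
      by (auto intro!: derivative_eq_intros)
    have "((\<lambda>y. gu y t) has_derivative (\<lambda>h. hu x t *v h)) (at (x + 0 *\<^sub>R axis i 1))"
      using bspec[OF H Q[OF assms(2)]] by auto
    from has_derivative_compose[OF 1 this]
    have "((\<lambda>s. gu (x + s *\<^sub>R axis i 1) t) has_derivative (\<lambda>s. hu x t *v (s *\<^sub>R axis i 1))) (at 0)" .
    from bounded_linear.has_derivative[OF bounded_linear_vec_nth this, of i]
    show "((\<lambda>s. gu (x + s *\<^sub>R axis i 1) t $ i) has_real_derivative hu x t $ i $ i) (at 0)"
      by (simp add: has_field_derivative_def matrix_vector_mult_scaleR matrix_vector_mul_component
          inner_axis mult_commute_abs)
  qed auto
  then show ?thesis using bspec[OF H Q[OF assms(2)]] unfolding hj_at_def by auto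
qed

text \<open>The shift by \<open>h\<close> preserves height and costs
  \<open>\<delta> * norm h\<close> by the spatial estimate. The shift in time is controlled on the
  unit ball around \<open>h + x\<close> by \<open>hj_time_difference\<close>, fed with the same
  spatial estimate.\<close>

lemma hj_translation_difference_small:
  fixes u :: "real^'n \<Rightarrow> real \<Rightarrow> real"
  assumes p: "p > 1"
    and sol: "\<And>x t. 0 < x $ k \<Longrightarrow> t \<le> t0 \<Longrightarrow> hj_at p u x t"
    and cont: "continuous_on ({x. 0 \<le> x $ k} \<times> {..t0}) (\<lambda>(x, t). u x t)"
    and growth: "\<And>c. c > 0 \<Longrightarrow> \<exists>K. \<forall>x t. 0 \<le> x $ k \<longrightarrow> t \<le> t0 \<longrightarrow> \<bar>u x t\<bar> \<le> K + c * x $ k"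
    and h: "h $ k = 0" and \<sigma>: "\<sigma> \<ge> 0" and e: "e > 0"
  shows "\<exists>X. \<forall>x t. X \<le> x $ k \<longrightarrow> t \<le> t0 \<longrightarrow> \<bar>u x t - u (h + x) (t - \<sigma>)\<bar> \<le> e"
proof -
  define n where "n = real CARD('n)"
  define A where "A = norm h + 1 + (4 * n + 5) * \<sigma>"
  have "0 \<le> (4 * n + 5) * \<sigma>" using \<sigma> by (simp add: n_def)
  then have A: "A > 0" using norm_ge_zero[of h] unfolding A_def by linarith
  \<comment> \<open>For \<open>\<delta> \<le> 1 / 4\<close> one has
    \<open>(4 * \<delta>) powr p \<le> 4 * \<delta>\<close>, so the total error is linear in
    \<open>\<delta>\<close>; its coefficient is \<open>A\<close>.\<close>
  define \<delta> where "\<delta> = min (1 / 4) (e / A)"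
  have \<delta>: "\<delta> > 0" "\<delta> \<le> 1 / 4" "\<delta> \<le> e / A"
    using e A unfolding \<delta>_def by (simp, intro min.cobounded1, intro min.cobounded2)
  have \<delta>A: "\<delta> * A \<le> e" using \<delta>(3) A by (simp add: field_simps)
  obtain X where X: "\<And>a b t. X \<le> a $ k \<Longrightarrow> norm (a - b) \<le> max 1 (norm h) \<Longrightarrow> t \<le> t0 \<Longrightarrow>
      u a t - u b t \<le> \<delta> * norm (a - b)"
    using hj_spatial_difference_small[OF p sol cont growth \<delta>(1), of "max 1 (norm h)"] by blast
  have X2: "\<bar>u a t - u b t\<bar> \<le> \<delta> * norm (a - b)"
    if "X \<le> a $ k" "X \<le> b $ k" "norm (a - b) \<le> max 1 (norm h)" "t \<le> t0" for a b t
    using X[of a b t] X[of b a t] that by (simp add: norm_minus_commute abs_le_iff)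
  have "\<bar>u x t - u (h + x) (t - \<sigma>)\<bar> \<le> e" if x: "max X 0 + 1 \<le> x $ k" and t: "t \<le> t0" for x t
  proof -
    have 1: "\<bar>u x t - u (h + x) t\<bar> \<le> \<delta> * norm h"
      using X2[of x "h + x" t] x t h by simp
    have height: "max X 0 \<le> y $ k" if "y \<in> cball (h + x) 1" for y
      using component_le_norm_cart[of "y - (h + x)" k] that x h
      by (auto simp: dist_norm norm_minus_commute)
    have "\<bar>u (h + x) t - u (h + x) (t - \<sigma>)\<bar>
        \<le> \<delta> + (4 * CARD('n) * \<delta> + (4 * \<delta>) powr p + \<delta>) * (t - (t - \<sigma>))"
    proof (rule hj_time_difference[OF p \<delta>(1)])
      show "hj_at p u y s" if "y \<in> ball (h + x) 1" "s \<le> t" for y s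
      proof -
        have "norm (y - (h + x)) < 1" using that by (simp add: dist_norm norm_minus_commute)
        then have "0 < y $ k"
          using component_le_norm_cart[of "y - (h + x)" k] x h by auto
        then show ?thesis using sol that t by simp
      qed
      show "continuous_on (cball (h + x) 1 \<times> {t - \<sigma>..t}) (\<lambda>(x, t). u x t)"
        by (rule continuous_on_subset[OF cont]) (use height t in fastforce)
      show "\<bar>u y s - u (h + x) s\<bar> \<le> \<delta> * norm (y - (h + x))" if "y \<in> cball (h + x) 1" "s \<le> t" for y s
      proof (rule X2)
        show "norm (y - (h + x)) \<le> max 1 (norm h)" using that by (simp add: dist_norm norm_minus_commute)
      qed (use height[OF that(1)] x h that t in auto)
    qed (use \<sigma> in auto)
    then have "\<bar>u (h + x) t - u (h + x) (t - \<sigma>)\<bar> \<le> \<delta> + (4 * n * \<delta> + (4 * \<delta>) powr p + \<delta>) * \<sigma>"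
      by (simp add: n_def)
    also have "(4 * \<delta>) powr p \<le> 4 * \<delta>"
      using powr_mono'[of 1 p "4 * \<delta>"] p \<delta> by simp
    finally have 2: "\<bar>u (h + x) t - u (h + x) (t - \<sigma>)\<bar> \<le> \<delta> + (4 * n * \<delta> + 4 * \<delta> + \<delta>) * \<sigma>"
      using \<sigma> by (simp add: mult_right_mono)
    have "\<delta> * norm h + (\<delta> + (4 * n * \<delta> + 4 * \<delta> + \<delta>) * \<sigma>) = \<delta> * A"
      by (simp add: A_def algebra_simps)
    then show ?thesis using 1 2 \<delta>A by linarith
  qed
  then show ?thesis by blast
qed

lemma closure_halfspace_Q:
  assumes "0 \<le> x $ k" "t < 0"
  shows "(x, t) \<in> closure (halfspace_Q k)"
proof -
  have "(\<lambda>j. (x + (1 / real (Suc j)) *\<^sub>R axis k 1, t)) \<longlonglongrightarrow> (x + 0 *\<^sub>R axis k 1, t)"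
    by (intro tendsto_intros LIMSEQ_inverse_real_of_nat[unfolded inverse_eq_divide])
  moreover have "(x + (1 / real (Suc j)) *\<^sub>R axis k 1, t) \<in> halfspace_Q k" for j
    using assms by (auto simp: halfspace_Q_def intro!: add_nonneg_pos)
  ultimately show ?thesis unfolding closure_sequential by fastforce
qed

text \<open>With \<open>t\<close> fixed, everything happens at times \<open>s \<le> t\<close>, which
  a shift backwards in time respects. Both \<open>u\<close> and its translate vanish on the boundary
  and get close at large height, so the comparison applies in both directions.\<close>

lemma ancient_solution_translation_invariant:
  fixes u :: "real^'n \<Rightarrow> real \<Rightarrow> real"
  assumes p: "p > 1" and u: "ancient_solution_halfspace k p u"
    and sublinear: "\<And>\<epsilon>. \<epsilon> > 0 \<Longrightarrow> \<forall>c>0. \<exists>R0. \<forall>R\<ge>R0. \<forall>x t.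
           0 < x $ k \<and> x $ k < R \<and> t \<le> -\<epsilon> \<longrightarrow> \<bar>u x t\<bar> \<le> c * R"
    and h: "h $ k = 0" and \<sigma>: "\<sigma> \<ge> 0" and x: "0 < x $ k" and t: "t < 0"
  shows "u (h + x) (t - \<sigma>) = u x t"
proof -
  define v where "v x s = u (h + x) (s - \<sigma>)" for x s
  have bd: "u y s = 0" if "y $ k = 0" "s \<le> t" for y s
    using u that t unfolding ancient_solution_halfspace_def by auto
  have sol: "hj_at p u y s" if "0 < y $ k" "s \<le> t" for y s
    using ancient_solution_hj_at[OF u] that t by simp
  have "{x. 0 \<le> x $ k} \<times> {..t} \<subseteq> closure (halfspace_Q k)"
    using closure_halfspace_Q t by fastforce
  then have cont: "continuous_on ({x. 0 \<le> x $ k} \<times> {..t}) (\<lambda>(x, t). u x t)"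
    using u continuous_on_subset unfolding ancient_solution_halfspace_def by blast
  \<comment> \<open>The sublinear growth, used with \<open>- t\<close> as \<open>\<epsilon>\<close>
    and slope \<open>c / 2\<close>, becomes an affine bound by taking
    \<open>R = \<bar>R0\<bar> + 2 * y $ k\<close>, which exceeds both \<open>R0\<close> and
    \<open>y $ k\<close>.\<close>
  have growth: "\<exists>K. \<forall>y s. 0 \<le> y $ k \<longrightarrow> s \<le> t \<longrightarrow> \<bar>u y s\<bar> \<le> K + c * y $ k" if c: "c > 0" for c
  proof -
    obtain R0 where R0: "\<And>R y s. R0 \<le> R \<Longrightarrow> 0 < y $ k \<Longrightarrow> y $ k < R \<Longrightarrow> s \<le> t \<Longrightarrow> \<bar>u y s\<bar> \<le> c / 2 * R"
      using sublinear[of "- t"] t c by (metis half_gt_zero minus_minus neg_0_less_iff_less)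
    have "\<bar>u y s\<bar> \<le> c / 2 * \<bar>R0\<bar> + c * y $ k" if y: "0 \<le> y $ k" and s: "s \<le> t" for y s
    proof (cases "y $ k = 0")
      case True
      then show ?thesis using bd s c by simp
    next
      case False
      then have "\<bar>u y s\<bar> \<le> c / 2 * (\<bar>R0\<bar> + 2 * y $ k)" using y s by (intro R0) auto
      then show ?thesis by (simp add: algebra_simps)
    qed
    then show ?thesis by blast
  qed
  have bounded: "\<exists>M. \<forall>y s. 0 \<le> y $ k \<longrightarrow> y $ k \<le> X \<longrightarrow> s \<le> t \<longrightarrow> \<bar>u y s\<bar> \<le> M" for X
  proof -
    obtain K where "\<And>y s. 0 \<le> y $ k \<Longrightarrow> s \<le> t \<Longrightarrow> \<bar>u y s\<bar> \<le> K + 1 * y $ k"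
      using growth[of 1] by auto
    then have "\<bar>u y s\<bar> \<le> K + X" if "0 \<le> y $ k" "y $ k \<le> X" "s \<le> t" for y s
      using that by fastforce
    then show ?thesis by blast
  qed
  have solv: "hj_at p v y s" if "0 < y $ k" "s \<le> t" for y s
    unfolding v_def by (rule hj_at_translate, rule sol) (use that h \<sigma> in auto)
  have contv: "continuous_on ({x. 0 \<le> x $ k} \<times> {..t}) (\<lambda>(x, t). v x t)"
  proof -
    have "continuous_on ({x. 0 \<le> x $ k} \<times> {..t}) (\<lambda>z. (\<lambda>(x, t). u x t) (h + fst z, snd z - \<sigma>))"
      by (rule continuous_on_compose2[OF cont]) (use h \<sigma> in \<open>auto intro!: continuous_intros\<close>)
    then show ?thesis by (simp add: v_def case_prod_beta)
  qed
  have boundedv: "\<exists>M. \<forall>y s. 0 \<le> y $ k \<longrightarrow> y $ k \<le> X \<longrightarrow> s \<le> t \<longrightarrow> \<bar>v y s\<bar> \<le> M" for X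
  proof -
    obtain M where M: "\<And>y s. 0 \<le> y $ k \<Longrightarrow> y $ k \<le> X \<Longrightarrow> s \<le> t \<Longrightarrow> \<bar>u y s\<bar> \<le> M"
      using bounded[of X] by blast
    have "\<bar>v y s\<bar> \<le> M" if "0 \<le> y $ k" "y $ k \<le> X" "s \<le> t" for y s
      unfolding v_def using that h \<sigma> by (intro M) auto
    then show ?thesis by blast
  qed
  have small: "\<exists>X. \<forall>y s. X \<le> y $ k \<longrightarrow> s \<le> t \<longrightarrow> \<bar>u y s - v y s\<bar> \<le> e" if "e > 0" for e
    unfolding v_def by (rule hj_translation_difference_small[OF p sol cont growth h \<sigma> that])
  have bdv: "v y s = u y s" if "y $ k = 0" "s \<le> t" for y s
    using bd[of y s] bd[of "h + y" "s - \<sigma>"] that h \<sigma> by (simp add: v_def)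
  have "u x t \<le> v x t"
  proof (rule hj_comparison_halfspace[OF p sol solv cont contv bounded boundedv])
    show "\<exists>X. \<forall>y s. X \<le> y $ k \<longrightarrow> s \<le> t \<longrightarrow> u y s - v y s \<le> e" if "e > 0" for e
      using small[OF that] by (fastforce simp: abs_le_iff)
  qed (use bdv x in auto)
  moreover have "v x t \<le> u x t"
  proof (rule hj_comparison_halfspace[OF p solv sol contv cont boundedv bounded])
    show "\<exists>X. \<forall>y s. X \<le> y $ k \<longrightarrow> s \<le> t \<longrightarrow> v y s - u y s \<le> e" if "e > 0" for e
      using small[OF that] by (fastforce simp: abs_le_iff)
  qed (use bdv x in auto)
  ultimately show ?thesis by (simp add: v_def)
qed

theorem theorem2p5:
  fixes p :: real and k :: "'n::finite" and u :: "real^'n \<Rightarrow> real \<Rightarrow> real"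
  assumes "p > 1"
    and "ancient_solution_halfspace k p u"
    and "\<And>\<epsilon>. \<epsilon> > 0 \<Longrightarrow> \<forall>c>0. \<exists>R0. \<forall>R\<ge>R0. \<forall>x t.
           0 < x $ k \<and> x $ k < R \<and> t \<le> -\<epsilon> \<longrightarrow> \<bar>u x t\<bar> \<le> c * R"
  shows "\<exists>g :: real \<Rightarrow> real. \<forall>x t. 0 < x $ k \<and> t < 0 \<longrightarrow> u x t = g (x $ k)"
proof (intro exI allI impI)
  fix x :: "real^'n" and t :: real
  assume xt: "0 < x $ k \<and> t < 0"
  note invariant = ancient_solution_translation_invariant[OF assms]
  have ex: "(axis k (x $ k) :: real^'n) $ k = x $ k" by (simp add: axis_def)
  \<comment> \<open>The profile is read off along the axis at time -1. Invariance only shifts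
    backwards in time, so the later of \<open>t\<close> and -1 is shifted to the earlier.\<close>
  show "u x t = u (axis k (x $ k)) (- 1)"
  proof (cases "t \<le> - 1")
    case True
    then show ?thesis
      using invariant[of "x - axis k (x $ k)" "- 1 - t" "axis k (x $ k)" "- 1"] xt ex by simp
  next
    case False
    then show ?thesis
      using invariant[of "axis k (x $ k) - x" "t + 1" x t] xt ex by simp
  qed
qed

end
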